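(* Suppose that: (i) there are positive constants $A,M$ independent of $N$ with $\frac1N\sum_{j=1}^N m_j=M$ and $\max_j |m_j|\le A$; (ii) there is a constant $\beta$ with $(z_1-z_2)\cdot(b(z_1)-b(z_2))\le\beta|z_1-z_2|^2$ for all $z_1,z_2\in\mathbb{R}^d$, and $b,\nabla b$ have polynomial growth, $|b(z)|+|\nabla b(z)|\le C_b(1+|z|)^{q}$ for some constants $C_b,q$; (iii) the functions $K_{ij}$ and their derivatives up to second order are bounded uniformly in $1\le i,j\le N$ (with bounds independent of $N$). Let $X$ be the solution of the full interacting particle system and $\tilde X$ the Random Batch Method process with time step $\tau$ and batch size $p$, and set $$J(t):=\frac{1}{2N}\sum_{i=1}^N m_i\,\mathbb{E}|\tilde X^i(t)-X^i(t)|^2 .$$ Then there is a constant $C$ independent of $N$, $p$ and $\tau$ (it may depend on $T$) such that $$\sup_{t\le T}J(t)\le C\sqrt{\frac{\tau}{p-1}+\tau^2}.$$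
   Context: Fix $d\ge1$, $T>0$, $\sigma\in\mathbb{R}$, a vector field $b:\mathbb{R}^d\to\mathbb{R}^d$ (independent of $N$), weights $m_j\ge0$ and kernels $K_{ij}:\mathbb{R}^d\times\mathbb{R}^d\to\mathbb{R}^d$, $1\le i,j\le N$. Full system: $X=(X^1,\dots,X^N)$ solves on $[0,T]$ $$dX^i=b(X^i)\,dt+\frac{1}{N-1}\sum_{j\ne i}m_jK_{ij}(X^i,X^j)\,dt+\sigma\,dW^i,\qquad X^i(0)=X_0^i,$$ with $W^1,\dots,W^N$ independent standard $d$-dimensional Brownian motions. Random Batch Method (RBM): let $N=np$ with batch size $p\ge2$, time step $\tau>0$, $t_k=k\tau$. At each $t_{k-1}$ ($k\ge1$), the index set $\{1,\dots,N\}$ is divided uniformly at random into $n$ batches of size $p$; this division is denoted $\mathcal{C}^{(k-1)}$. For $t\in[t_{k-1},t_k)$, the (time-continuous) process $\tilde X$ solves, for each batch $\mathcal{C}_q$ of $\mathcal{C}^{(k-1)}$ and each $i\in\mathcal{C}_q$, $$d\tilde X^i=b(\tilde X^i)\,dt+\frac{1}{p-1}\sum_{j\in\mathcal{C}_q,\,j\ne i}m_jK_{ij}(\tilde X^i,\tilde X^j)\,dt+\sigma\,dW^i,$$ with the same initial values $\tilde X^i(0)=X_0^i$ and the same Brownian motions $W^i$ as the full system. The random variables $X_0^i$, $W^i$ ($1\le i\le N$), $\mathcal{C}^{(k)}$ ($k\ge0$) are defined on a common probability space and are all independent. $\mathbb{E}$ denotes expectation on this space. *)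

theory Defs
  imports "HOL-Probability.Probability"
begin

text \<open>
  Standard Brownian motion with values in \<open>real ^ 'd\<close>, time set \<open>[0, \<infinity>)\<close>; increments over
  \<open>[s, t]\<close> have law \<open>N(0, (t - s) I)\<close>.
\<close>

definition standard_brownian_motion ::
    "'w measure \<Rightarrow> (real \<Rightarrow> 'w \<Rightarrow> real ^ 'd) \<Rightarrow> bool" where
  "standard_brownian_motion P W \<longleftrightarrow>
     (\<forall>t\<ge>0. W t \<in> borel_measurable P) \<and>
     (AE \<omega> in P. W 0 \<omega> = 0) \<and>
     (AE \<omega> in P. continuous_on {0..} (\<lambda>t. W t \<omega>)) \<and>
     (\<forall>s t. 0 \<le> s \<and> s < t \<longrightarrow>
        distributed P lborel (\<lambda>\<omega>. W t \<omega> - W s \<omega>)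
          (\<lambda>x. ennreal (\<Prod>c\<in>UNIV. normal_density 0 (sqrt (t - s)) (x $ c)))) \<and>
     (\<forall>u :: nat \<Rightarrow> real. 0 \<le> u 0 \<and> mono u \<longrightarrow>
        (\<forall>l. prob_space.indep_vars P (\<lambda>_. borel)
               (\<lambda>k \<omega>. W (u (Suc k)) \<omega> - W (u k) \<omega>) {..<l}))"

definition batch_divisions :: "nat \<Rightarrow> nat \<Rightarrow> nat set set set" where
  "batch_divisions n p =
     {D. partition_on {1..n * p} D \<and> card D = n \<and> (\<forall>B\<in>D. card B = p)}"

datatype source = Init nat | Noise nat | Batch nat

text \<open>
  The random inputs take values in different spaces, so their joint independence is expressed
  through the sigma-algebras they generate; each Brownian motion enters as a whole path.
\<close>

fun source_sigma ::
    "'w measure \<Rightarrow> nat \<Rightarrow> nat \<Rightarrow> (nat \<Rightarrow> 'w \<Rightarrow> real ^ 'd) \<Rightarrow> (nat \<Rightarrow> real \<Rightarrow> 'w \<Rightarrow> real ^ 'd)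
      \<Rightarrow> (nat \<Rightarrow> 'w \<Rightarrow> nat set set) \<Rightarrow> source \<Rightarrow> 'w set set" where
  "source_sigma P n p X0 W D (Init i) = sets (vimage_algebra (space P) (X0 i) borel)"
| "source_sigma P n p X0 W D (Noise i) =
     sets (vimage_algebra (space P) (\<lambda>\<omega>. \<lambda>t\<in>{0..}. W i t \<omega>) (Pi\<^sub>M {0..} (\<lambda>_. borel)))"
| "source_sigma P n p X0 W D (Batch k) =
     sets (vimage_algebra (space P) (D k) (count_space (batch_divisions n p)))"

text \<open>\<open>D k\<close> is the division drawn at time \<open>k \<tau>\<close>; particles are numbered \<open>1, \<dots>, n * p\<close>.\<close>

definition random_inputs ::
    "'w measure \<Rightarrow> nat \<Rightarrow> nat \<Rightarrow> (nat \<Rightarrow> 'w \<Rightarrow> real ^ 'd) \<Rightarrow> (nat \<Rightarrow> real \<Rightarrow> 'w \<Rightarrow> real ^ 'd)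
      \<Rightarrow> (nat \<Rightarrow> 'w \<Rightarrow> nat set set) \<Rightarrow> bool" where
  "random_inputs P n p X0 W D \<longleftrightarrow>
     prob_space P \<and>
     (\<forall>i\<in>{1..n * p}. X0 i \<in> borel_measurable P) \<and>
     (\<forall>i\<in>{1..n * p}. standard_brownian_motion P (W i)) \<and>
     (\<forall>k. D k \<in> measurable P (count_space (batch_divisions n p)) \<and>
          distr P (count_space (batch_divisions n p)) (D k)
            = uniform_count_measure (batch_divisions n p)) \<and>
     prob_space.indep_sets P (source_sigma P n p X0 W D)
       (Init ` {1..n * p} \<union> Noise ` {1..n * p} \<union> range Batch)"

text \<open>
  The drift of particle \<open>i\<close> at configuration \<open>x\<close> when it interacts with the other members of the
  index set \<open>B\<close>: \<open>B\<close> is \<open>{1..N}\<close> for the full system and the batch of \<open>i\<close> for the batch method.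
\<close>

definition drift ::
    "(real ^ 'd \<Rightarrow> real ^ 'd) \<Rightarrow> (nat \<Rightarrow> real)
      \<Rightarrow> (nat \<Rightarrow> nat \<Rightarrow> (real ^ 'd) \<times> (real ^ 'd) \<Rightarrow> real ^ 'd)
      \<Rightarrow> nat set \<Rightarrow> nat \<Rightarrow> (nat \<Rightarrow> real ^ 'd) \<Rightarrow> real ^ 'd" where
  "drift b m K B i x =
     b (x i) + (1 / (real (card B) - 1)) *\<^sub>R (\<Sum>j\<in>B - {i}. m j *\<^sub>R K i j (x i, x j))"

text \<open>
  Since the diffusion coefficient is constant, the stochastic integral of \<open>\<sigma>\<close> against \<open>W\<close> is
  \<open>\<sigma> W\<close>, and a solution is a process with continuous paths satisfying the integral equation
  almost surely. Adaptedness is not demanded of a solution.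
\<close>

definition full_system_solution ::
    "'w measure \<Rightarrow> real \<Rightarrow> nat \<Rightarrow> real \<Rightarrow> (real ^ 'd \<Rightarrow> real ^ 'd) \<Rightarrow> (nat \<Rightarrow> real)
      \<Rightarrow> (nat \<Rightarrow> nat \<Rightarrow> (real ^ 'd) \<times> (real ^ 'd) \<Rightarrow> real ^ 'd)
      \<Rightarrow> (nat \<Rightarrow> 'w \<Rightarrow> real ^ 'd) \<Rightarrow> (nat \<Rightarrow> real \<Rightarrow> 'w \<Rightarrow> real ^ 'd)
      \<Rightarrow> (nat \<Rightarrow> real \<Rightarrow> 'w \<Rightarrow> real ^ 'd) \<Rightarrow> bool" where
  "full_system_solution P T N \<sigma> b m K X0 W X \<longleftrightarrow>
     (\<forall>i\<in>{1..N}. \<forall>t\<in>{0..T}. X i t \<in> borel_measurable P) \<and>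
     (AE \<omega> in P. \<forall>i\<in>{1..N}.
        continuous_on {0..T} (\<lambda>t. X i t \<omega>) \<and>
        (\<forall>t\<in>{0..T}.
           X i t \<omega> = X0 i \<omega> + integral {0..t} (\<lambda>s. drift b m K {1..N} i (\<lambda>j. X j s \<omega>))
                      + \<sigma> *\<^sub>R W i t \<omega>))"

definition random_batch_solution ::
    "'w measure \<Rightarrow> real \<Rightarrow> nat \<Rightarrow> real \<Rightarrow> (real ^ 'd \<Rightarrow> real ^ 'd) \<Rightarrow> (nat \<Rightarrow> real)
      \<Rightarrow> (nat \<Rightarrow> nat \<Rightarrow> (real ^ 'd) \<times> (real ^ 'd) \<Rightarrow> real ^ 'd)
      \<Rightarrow> (nat \<Rightarrow> 'w \<Rightarrow> real ^ 'd) \<Rightarrow> (nat \<Rightarrow> real \<Rightarrow> 'w \<Rightarrow> real ^ 'd)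
      \<Rightarrow> real \<Rightarrow> (nat \<Rightarrow> 'w \<Rightarrow> nat set set)
      \<Rightarrow> (nat \<Rightarrow> real \<Rightarrow> 'w \<Rightarrow> real ^ 'd) \<Rightarrow> bool" where
  "random_batch_solution P T N \<sigma> b m K X0 W \<tau> D X \<longleftrightarrow>
     (\<forall>i\<in>{1..N}. \<forall>t\<in>{0..T}. X i t \<in> borel_measurable P) \<and>
     (AE \<omega> in P.
        (\<forall>i\<in>{1..N}. continuous_on {0..T} (\<lambda>t. X i t \<omega>) \<and> X i 0 \<omega> = X0 i \<omega>) \<and>
        (\<forall>k. \<forall>B\<in>D k \<omega>. \<forall>i\<in>B. \<forall>t\<in>{0..T}. real k * \<tau> \<le> t \<and> t < real (Suc k) * \<tau> \<longrightarrow>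
           X i t \<omega> = X i (real k * \<tau>) \<omega>
             + integral {real k * \<tau>..t} (\<lambda>s. drift b m K B i (\<lambda>j. X j s \<omega>))
             + \<sigma> *\<^sub>R (W i t \<omega> - W i (real k * \<tau>) \<omega>)))"

definition C2_bounded_by ::
    "real \<Rightarrow> ('a::real_normed_vector \<Rightarrow> 'b::real_normed_vector) \<Rightarrow> bool" where
  "C2_bounded_by L f \<longleftrightarrow>
     (\<exists>(f' :: 'a \<Rightarrow> 'a \<Rightarrow>\<^sub>L 'b) (f'' :: 'a \<Rightarrow> 'a \<Rightarrow>\<^sub>L ('a \<Rightarrow>\<^sub>L 'b)).
        (\<forall>x. (f has_derivative blinfun_apply (f' x)) (at x)) \<and>
        (\<forall>x. (f' has_derivative blinfun_apply (f'' x)) (at x)) \<and>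
        (\<forall>x. norm (f x) \<le> L \<and> norm (f' x) \<le> L \<and> norm (f'' x) \<le> L))"

text \<open>
  The expectation is the nonnegative Lebesgue integral, so that it is infinite rather than \<open>0\<close>
  if the square were not integrable.
\<close>

definition weighted_error ::
    "'w measure \<Rightarrow> nat \<Rightarrow> (nat \<Rightarrow> real) \<Rightarrow> (nat \<Rightarrow> real \<Rightarrow> 'w \<Rightarrow> real ^ 'd)
      \<Rightarrow> (nat \<Rightarrow> real \<Rightarrow> 'w \<Rightarrow> real ^ 'd) \<Rightarrow> real \<Rightarrow> ennreal" where
  "weighted_error P N m Xt X t =
     ennreal (1 / (2 * real N)) *
       (\<Sum>i\<in>{1..N}. ennreal (m i) * (\<integral>\<^sup>+ \<omega>. ennreal ((norm (Xt i t \<omega> - X i t \<omega>))\<^sup>2) \<partial>P))"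

end

theory Submission
  imports Defs
begin

text \<open>
  Nothing is assumed about the moments of the initial data, so increments of a single solution cannot be
  estimated in mean. Two choices avoid them: the random force is evaluated along the full system \<open>X\<close>,
  which is independent of all divisions (replacing the batch process by \<open>X\<close> there costs only
  \<open>|Z|\<^sup>2\<close>, where \<open>Z\<close> is the difference of the two processes); and within a period the batch process
  is compared with the one whose current division is replaced by a fixed one. By the one-sided Lipschitz
  condition the two differ by \<open>O(\<tau>)\<close>, and the replaced process is independent of the current division,
  over which the random force averages to zero. Hence the cross term is \<open>O(\<tau>)\<close> and Gronwall's lemma gives
  \<open>J = O(\<tau>)\<close>, which is stronger than the claim.

  The argument is carried out for explicit Euler schemes with globally Lipschitz truncations of \<open>b\<close>.
  These are explicit functions of the random inputs, so no existence theory and no adaptedness of the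
  given solutions is needed; they converge to the given solutions path by path, and Fatou's lemma
  transfers the bound.
\<close>

section \<open>Vector fields\<close>

text \<open>The obstacle is to keep the constants independent of the truncation. On a ball of radius
  R the Lipschitz constant \<open>\<Lambda>\<close> of the truncated field may grow without control
  in R, while its one-sided constant stays at \<open>\<bar>\<beta>\<bar> + 1\<close>. The
  mean-square estimate sees \<open>\<Lambda>\<close> only through the step-size condition
  \<open>h * \<Lambda>\<^sup>2 \<le> 1\<close>, which costs nothing as h tends to 0; in an error
  bound it occurs only for pathwise convergence, where the truncation is fixed. So the step size
  tends to 0 first and the radius to infinity afterwards, with Fatou's lemma applied at each limit.
  Conditional expectations are avoided as well. Up to time T finitely many divisions are drawn, each
  from a finite set, so for frozen initial data and noise the mean is a finite sum over sequences of
  divisions. The rate is a product: a displacement of order \<open>\<tau>\<close> within a period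
  times a fluctuation bounded by \<open>2 * (A * L)\<close>. Neither factor depends on p or
  N.\<close>

text \<open>
  Composing \<open>b\<close> with the projection \<open>c\<close> onto the ball destroys the one-sided bound; the damping
  \<open>- (l\<^sup>2 / 4) (x - c x)\<close> restores it because \<open>c\<close> is firmly nonexpansive.
\<close>

lemma one_sided_lipschitz_truncation:
  fixes b :: "'a::euclidean_space \<Rightarrow> 'a"
  assumes osl: "\<And>x y. (x - y) \<bullet> (b x - b y) \<le> \<beta> * (norm (x - y))\<^sup>2"
    and lip: "\<And>x y. norm x \<le> R \<Longrightarrow> norm y \<le> R \<Longrightarrow> norm (b x - b y) \<le> l * norm (x - y)"
    and "R \<ge> 0" "l \<ge> 0"
  obtains f \<Lambda> where "\<Lambda> \<ge> 0" "\<And>x y. norm (f x - f y) \<le> \<Lambda> * norm (x - y)"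
    "\<And>x y. (x - y) \<bullet> (f x - f y) \<le> (\<bar>\<beta>\<bar> + 1) * (norm (x - y))\<^sup>2"
    "\<And>x. norm x \<le> R \<Longrightarrow> f x = b x"
proof -
  let ?S = "cball (0::'a) R"
  define c where "c = closest_point ?S"
  define f where "f x = b (c x) - (l\<^sup>2 / 4) *\<^sub>R (x - c x)" for x
  have S: "closed ?S" "convex ?S" "?S \<noteq> {}" using \<open>R \<ge> 0\<close> by auto
  have cin: "norm (c x) \<le> R" for x
    using closest_point_in_set[OF S(1,3), of x] by (simp add: c_def)
  have cself: "c x = x" if "norm x \<le> R" for x
    using closest_point_self[of x ?S] that by (simp add: c_def)
  have clip: "norm (c x - c y) \<le> norm (x - y)" for x y
    using closest_point_lipschitz[OF S(2,1,3), of x y] by (simp add: c_def dist_norm)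
  \<comment> \<open>The variational inequality of the projection. Applied at both points and added,
    it yields the firm nonexpansiveness \<open>uv\<close> below.\<close>
  have dot: "(x - c x) \<bullet> (y - c x) \<le> 0" if "norm y \<le> R" for x y
    using closest_point_dot[OF S(2,1), of y x] that by (simp add: c_def)
  have blip: "norm (b (c x) - b (c y)) \<le> l * norm (c x - c y)" for x y
    by (intro lip cin)
  show thesis
  proof (rule that[of "l + l\<^sup>2 / 2" f])
    show "l + l\<^sup>2 / 2 \<ge> 0" using \<open>l \<ge> 0\<close> by simp
    show "f x = b x" if "norm x \<le> R" for x using cself[OF that] by (simp add: f_def)
    fix x y
    let ?u = "c x - c y" and ?v = "(x - c x) - (y - c y)" and ?w = "b (c x) - b (c y)"
    have f: "f x - f y = ?w - (l\<^sup>2 / 4) *\<^sub>R ?v"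
      by (simp add: f_def algebra_simps)
    have xy: "x - y = ?u + ?v" by simp
    have "norm ?v \<le> norm (x - y) + norm ?u"
      using norm_triangle_ineq4[of "x - y" ?u] by (simp add: algebra_simps)
    then have v: "norm ?v \<le> 2 * norm (x - y)" using clip[of x y] by linarith
    have "norm (f x - f y) \<le> norm ?w + l\<^sup>2 / 4 * norm ?v"
      unfolding f by (rule order_trans[OF norm_triangle_ineq4]) simp
    also have "\<dots> \<le> l * norm (x - y) + l\<^sup>2 / 4 * (2 * norm (x - y))"
      using v order_trans[OF blip mult_left_mono[OF clip \<open>l \<ge> 0\<close>]]
      by (intro add_mono mult_left_mono) auto
    finally show "norm (f x - f y) \<le> (l + l\<^sup>2 / 2) * norm (x - y)"
      by (simp add: algebra_simps)
    have uv: "?u \<bullet> ?v \<ge> 0"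
      using dot[OF cin[of y], of x] dot[OF cin[of x], of y]
      by (simp add: inner_diff_left inner_diff_right inner_commute algebra_simps)
    have "(norm (x - y))\<^sup>2 = (norm ?u)\<^sup>2 + (norm ?v)\<^sup>2 + 2 * (?u \<bullet> ?v)"
      unfolding xy by (simp only: power2_norm_eq_inner inner_add_left inner_add_right inner_commute)
    then have u: "(norm ?u)\<^sup>2 \<le> (norm (x - y))\<^sup>2"
      using uv zero_le_power2[of "norm ?v"] by linarith
    have "?v \<bullet> ?w \<le> norm ?v * norm ?w" by (rule norm_cauchy_schwarz)
    also have "\<dots> \<le> norm ?v * (l * norm ?u)" by (intro mult_left_mono blip) simp
    \<comment> \<open>Young's inequality, weighted so that the term in \<open>?v\<close> is exactly
      what the damping removes. This fixes the coefficient \<open>l\<^sup>2 / 4\<close>, and the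
      remaining square of \<open>?u\<close> is the 1 added to
      \<open>\<bar>\<beta>\<bar>\<close>.\<close>
    also have "\<dots> \<le> l\<^sup>2 / 4 * (norm ?v)\<^sup>2 + (norm ?u)\<^sup>2"
      using zero_le_power2[of "l / 2 * norm ?v - norm ?u"] by (simp add: power2_eq_square algebra_simps)
    finally have 1: "?v \<bullet> ?w \<le> l\<^sup>2 / 4 * (norm ?v)\<^sup>2 + (norm ?u)\<^sup>2" .
    have 2: "?u \<bullet> ?w \<le> \<beta> * (norm ?u)\<^sup>2" by (rule osl)
    have "(u + v) \<bullet> (w - k *\<^sub>R v) = u \<bullet> w + v \<bullet> w - k * (u \<bullet> v) - k * (norm v)\<^sup>2"
      for u v w :: 'a and k
      unfolding power2_norm_eq_inner by (simp add: inner_add_left inner_diff_right algebra_simps)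
    then have "(x - y) \<bullet> (f x - f y) =
        ?u \<bullet> ?w + ?v \<bullet> ?w - l\<^sup>2 / 4 * (?u \<bullet> ?v) - l\<^sup>2 / 4 * (norm ?v)\<^sup>2"
      unfolding f by (metis xy)
    also have "\<dots> \<le> \<beta> * (norm ?u)\<^sup>2 + (norm ?u)\<^sup>2"
      using 1 2 mult_nonneg_nonneg[OF _ uv, of "l\<^sup>2 / 4"] by simp
    also have "\<dots> \<le> (\<bar>\<beta>\<bar> + 1) * (norm ?u)\<^sup>2"
      by (simp add: distrib_right mult_right_mono)
    also have "\<dots> \<le> (\<bar>\<beta>\<bar> + 1) * (norm (x - y))\<^sup>2"
      using u by (intro mult_left_mono) auto
    finally show "(x - y) \<bullet> (f x - f y) \<le> (\<bar>\<beta>\<bar> + 1) * (norm (x - y))\<^sup>2" .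
  qed
qed

lemma C2_bounded_by_bound: "C2_bounded_by L f \<Longrightarrow> norm (f x) \<le> L"
  by (auto simp: C2_bounded_by_def)

lemma C2_bounded_by_lipschitz:
  assumes "C2_bounded_by L f"
  shows "norm (f x - f y) \<le> L * norm (x - y)"
proof -
  obtain f' where f': "\<And>x. (f has_derivative blinfun_apply (f' x)) (at x)" "\<And>x. norm (f' x) \<le> L"
    using assms by (auto simp: C2_bounded_by_def)
  show ?thesis
    by (rule differentiable_bound[of UNIV f "\<lambda>x. blinfun_apply (f' x)"])
      (use f' in \<open>auto simp: norm_blinfun.rep_eq[symmetric]\<close>)
qed

text \<open>Mean value inequality on the convex ball. Absolute values enter the constant because
  neither \<open>C\<close> nor \<open>q\<close> has a prescribed sign; the base is at least 1, so
  passing to the exponent \<open>\<bar>q\<bar>\<close> only enlarges the bound.\<close>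

lemma locally_lipschitz_of_derivative_growth:
  fixes b :: "'a::euclidean_space \<Rightarrow> 'b::euclidean_space"
  assumes "\<And>z. b differentiable (at z)"
    and growth: "\<And>z. norm (b z) + onorm (frechet_derivative b (at z)) \<le> C * (1 + norm z) powr q"
    and "R \<ge> 0"
  obtains l where "l \<ge> 0"
    "\<And>x y. norm x \<le> R \<Longrightarrow> norm y \<le> R \<Longrightarrow> norm (b x - b y) \<le> l * norm (x - y)"
proof (rule that[of "\<bar>C\<bar> * (1 + R) powr \<bar>q\<bar>"])
  fix x y :: 'a assume xy: "norm x \<le> R" "norm y \<le> R"
  show "norm (b x - b y) \<le> \<bar>C\<bar> * (1 + R) powr \<bar>q\<bar> * norm (x - y)"
  proof (rule differentiable_bound[of "cball 0 R" b "\<lambda>z. frechet_derivative b (at z)"])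
    show "(b has_derivative frechet_derivative b (at z)) (at z within cball 0 R)" for z
      using assms(1) by (meson frechet_derivative_works has_derivative_at_withinI)
    fix z assume z: "z \<in> cball (0::'a) R"
    have "onorm (frechet_derivative b (at z)) \<le> C * (1 + norm z) powr q"
      using growth[of z] norm_ge_zero[of "b z"] by linarith
    also have "\<dots> \<le> \<bar>C\<bar> * (1 + norm z) powr q" by (intro mult_right_mono) auto
    also have "\<dots> \<le> \<bar>C\<bar> * (1 + norm z) powr \<bar>q\<bar>" by (intro mult_left_mono powr_mono) auto
    also have "\<dots> \<le> \<bar>C\<bar> * (1 + R) powr \<bar>q\<bar>"
      using z by (intro mult_left_mono powr_mono2) auto
    finally show "onorm (frechet_derivative b (at z)) \<le> \<bar>C\<bar> * (1 + R) powr \<bar>q\<bar>" .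
  qed (use xy in auto)
qed simp

section \<open>Random divisions into batches\<close>

text \<open>The number of batches is not recorded and \<open>p = N\<close> is allowed, so the single
  batch \<open>{1..N}\<close> qualifies and the full system becomes a batch system.\<close>

definition batches :: "nat \<Rightarrow> nat \<Rightarrow> nat set set \<Rightarrow> bool" where
  "batches N p d \<longleftrightarrow> 2 \<le> p \<and> partition_on {1..N} d \<and> (\<forall>B\<in>d. card B = p)"

definition batch_of :: "nat set set \<Rightarrow> nat \<Rightarrow> nat set" where
  "batch_of d i = (THE B. B \<in> d \<and> i \<in> B)"

lemma batch_of_eq:
  assumes "partition_on S d" "B \<in> d" "i \<in> B"
  shows "batch_of d i = B"
  unfolding batch_of_def
proof (rule the_equality)
  show "B' = B" if "B' \<in> d \<and> i \<in> B'" for B'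
    using partition_onD2[OF assms(1)] assms that by (metis disjnt_iff pairwiseD)
qed (use assms in auto)

lemma batch_of_mem:
  assumes "partition_on S d" "i \<in> S"
  shows "batch_of d i \<in> d" "i \<in> batch_of d i"
proof -
  obtain B where "B \<in> d" "i \<in> B"
    using assms by (auto dest!: partition_onD1)
  then show "batch_of d i \<in> d" "i \<in> batch_of d i"
    using batch_of_eq[OF assms(1)] by auto
qed

lemma batches_single: "2 \<le> N \<Longrightarrow> batches N N {{1..N}}"
  by (auto simp: batches_def partition_on_def disjoint_def)

lemma batch_of_subset:
  assumes "batches N p d" "i \<in> {1..N}"
  shows "batch_of d i \<subseteq> {1..N}" "finite (batch_of d i)" "card (batch_of d i) = p"
proof -
  have "batch_of d i \<in> d" using assms batch_of_mem by (auto simp: batches_def)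
  then show 1: "batch_of d i \<subseteq> {1..N}" and "card (batch_of d i) = p"
    using assms by (auto simp: batches_def partition_on_def)
  then show "finite (batch_of d i)" by (auto intro: finite_subset)
qed

lemma batch_of_sym:
  assumes "batches N p d" "i \<in> {1..N}" "j \<in> {1..N}"
  shows "j \<in> batch_of d i \<longleftrightarrow> i \<in> batch_of d j"
  using assms batch_of_mem[of "{1..N}" d] batch_of_eq[of "{1..N}" d] unfolding batches_def by metis

text \<open>Double counting: sharing a batch is symmetric and every \<open>j\<close> has
  \<open>p - 1\<close> companions, so \<open>f j\<close> is counted \<open>p - 1\<close> times. This
  will cancel the normalisation of the interaction.\<close>

lemma sum_batch_others:
  fixes f :: "nat \<Rightarrow> real"
  assumes d: "batches N p d"
  shows "(\<Sum>i=1..N. \<Sum>j\<in>batch_of d i - {i}. f j) = (real p - 1) * (\<Sum>j=1..N. f j)"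
proof -
  have eq: "batch_of d i - {i} = {j \<in> {1..N}. j \<in> batch_of d i \<and> j \<noteq> i}" if "i \<in> {1..N}" for i
    using batch_of_subset(1)[OF d that] by auto
  have "(\<Sum>i=1..N. \<Sum>j\<in>batch_of d i - {i}. f j)
      = (\<Sum>i=1..N. \<Sum>j | j \<in> {1..N} \<and> (j \<in> batch_of d i \<and> j \<noteq> i). f j)"
    using eq by (intro sum.cong) auto
  also have "\<dots> = (\<Sum>j=1..N. \<Sum>i | i \<in> {1..N} \<and> (j \<in> batch_of d i \<and> j \<noteq> i). f j)"
    by (rule sum.swap_restrict) auto
  also have "\<dots> = (\<Sum>j=1..N. \<Sum>i\<in>batch_of d j - {j}. f j)"
  proof (intro sum.cong refl)
    fix j assume j: "j \<in> {1..N}"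
    show "{i \<in> {1..N}. j \<in> batch_of d i \<and> j \<noteq> i} = batch_of d j - {j}"
      unfolding eq[OF j] using batch_of_sym[OF d _ j] by blast
  qed
  also have "\<dots> = (\<Sum>j=1..N. (real p - 1) * f j)"
  proof (intro sum.cong refl)
    fix j assume j: "j \<in> {1..N}"
    have "card (batch_of d j - {j}) = p - 1" "p \<ge> 1"
      using batch_of_subset[OF d j] batch_of_mem(2)[of "{1..N}" d j] d j by (auto simp: batches_def)
    then show "(\<Sum>i\<in>batch_of d j - {j}. f j) = (real p - 1) * f j" by simp
  qed
  finally show ?thesis by (simp add: sum_distrib_left)
qed

lemma finite_batch_divisions: "finite (batch_divisions n p)"
  by (rule finite_subset[of _ "Pow (Pow {1..n * p})"])
    (auto simp: batch_divisions_def partition_on_def)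

lemma batch_divisions_batches: "d \<in> batch_divisions n p \<Longrightarrow> 2 \<le> p \<Longrightarrow> batches (n * p) p d"
  by (auto simp: batch_divisions_def batches_def)

lemma batch_divisions_permute:
  assumes "bij_betw \<pi> {1..n * p} {1..n * p}" "d \<in> batch_divisions n p"
  shows "(`) \<pi> ` d \<in> batch_divisions n p"
proof -
  have inj: "inj_on \<pi> {1..n*p}" and im: "\<pi> ` {1..n*p} = {1..n*p}"
    using assms(1) by (auto simp: bij_betw_def)
  have d: "partition_on {1..n*p} d" "card d = n" "\<And>B. B \<in> d \<Longrightarrow> card B = p"
    using assms(2) by (auto simp: batch_divisions_def)
  have sub: "B \<subseteq> {1..n*p}" if "B \<in> d" for B
    using d(1) that by (auto simp: partition_on_def)
  have inj': "inj_on ((`) \<pi>) d"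
    by (rule inj_on_subset[OF inj_on_image_Pow[OF inj]]) (use sub in auto)
  have "{} \<notin> (`) \<pi> ` d" using partition_onD3[OF d(1)] by auto
  then have "partition_on {1..n*p} ((`) \<pi> ` d)"
    using partition_on_inj_image[OF d(1) inj] im by simp
  moreover have "card (\<pi> ` B) = p" if "B \<in> d" for B
    using card_image[OF inj_on_subset[OF inj sub[OF that]]] d(3)[OF that] by simp
  ultimately show ?thesis
    using card_image[OF inj'] d(2) by (auto simp: batch_divisions_def)
qed

text \<open>The transposition of \<open>j\<close> and \<open>j'\<close> fixes \<open>i\<close> and
  acts injectively on divisions, sending those that join \<open>j\<close> to \<open>i\<close> to
  those that join \<open>j'\<close> to \<open>i\<close>. Used in both directions it gives
  equality.\<close>

lemma card_batch_with:
  assumes p: "2 \<le> p" and ij: "i \<in> {1..n * p}" "j \<in> {1..n * p}" "j' \<in> {1..n * p}" "j \<noteq> i" "j' \<noteq> i"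
  shows "card {d \<in> batch_divisions n p. j \<in> batch_of d i}
       \<le> card {d \<in> batch_divisions n p. j' \<in> batch_of d i}"
proof -
  let ?\<pi> = "Transposition.transpose j j'"
  have bij: "bij_betw ?\<pi> {1..n*p} {1..n*p}"
    using ij by (intro bij_betw_byWitness[where f' = ?\<pi>]) (auto simp: Transposition.transpose_def)
  show ?thesis
  proof (rule card_inj_on_le[where f = "\<lambda>d. (`) ?\<pi> ` d"])
    have "inj ((`) ((`) ?\<pi>))"
      using inj_on_image_Pow[OF inj_on_image_Pow[of ?\<pi> UNIV]] by simp
    then show "inj_on (\<lambda>d. (`) ?\<pi> ` d) {d \<in> batch_divisions n p. j \<in> batch_of d i}"
      by (rule inj_on_subset) simp
    show "(\<lambda>d. (`) ?\<pi> ` d) ` {d \<in> batch_divisions n p. j \<in> batch_of d i}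
        \<subseteq> {d \<in> batch_divisions n p. j' \<in> batch_of d i}"
    proof clarify
      fix d assume d: "d \<in> batch_divisions n p" and j: "j \<in> batch_of d i"
      have d': "(`) ?\<pi> ` d \<in> batch_divisions n p" by (rule batch_divisions_permute[OF bij d])
      have m: "batch_of d i \<in> d" "i \<in> batch_of d i"
        using batch_of_mem[of "{1..n*p}" d i] d ij by (auto simp: batch_divisions_def)
      have "i \<in> ?\<pi> ` batch_of d i" using m ij by (auto intro!: image_eqI[of _ _ i])
      moreover have "j' \<in> ?\<pi> ` batch_of d i" using j by (auto intro!: image_eqI[of _ _ j])
      ultimately have "j' \<in> batch_of ((`) ?\<pi> ` d) i"
        using batch_of_eq[of "{1..n*p}" "(`) ?\<pi> ` d" "?\<pi> ` batch_of d i" i] d' m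
        by (auto simp: batch_divisions_def)
      then show "(`) ?\<pi> ` d \<in> batch_divisions n p \<and> j' \<in> batch_of ((`) ?\<pi> ` d) i"
        using d' by simp
    qed
  qed (use finite_batch_divisions in auto)
qed

text \<open>The batch force is unbiased. By symmetry every other particle shares the batch of
  \<open>i\<close> in the same number \<open>c\<close> of divisions; counting pairs of a division
  and a companion of \<open>i\<close> relates \<open>c\<close> to the number of divisions, and the
  two normalisations match.\<close>

lemma sum_batch_divisions:
  fixes v :: "nat \<Rightarrow> 'a::real_vector"
  assumes p: "2 \<le> p" and i: "i \<in> {1..n * p}"
  shows "(\<Sum>d\<in>batch_divisions n p. (1 / (real p - 1)) *\<^sub>R (\<Sum>j\<in>batch_of d i - {i}. v j))
       = (\<Sum>d\<in>batch_divisions n p. (1 / (real (n * p) - 1)) *\<^sub>R (\<Sum>j\<in>{1..n * p} - {i}. v j))"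
proof -
  let ?D = "batch_divisions n p" and ?I = "{1..n * p} - {i}"
  have "n \<ge> 1" using i by (cases n) auto
  then have N2: "n * p \<ge> 2" using p by (metis mult_le_mono nat_mult_1)
  then have "(if i = 1 then 2 else 1) \<in> ?I" using \<open>n \<ge> 1\<close> p by auto
  then obtain j0 where j0: "j0 \<in> ?I" by blast
  define c where "c = card {d \<in> ?D. j0 \<in> batch_of d i}"
  have c: "card {d \<in> ?D. j \<in> batch_of d i} = c" if "j \<in> ?I" for j
    unfolding c_def using that j0 i by (intro antisym card_batch_with[OF p]) auto
  have "(\<Sum>d\<in>?D. \<Sum>j\<in>batch_of d i - {i}. w j) = (\<Sum>j\<in>?I. real c *\<^sub>R w j)"
    for w :: "nat \<Rightarrow> 'b::real_vector"
  proof -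
    have "(\<Sum>d\<in>?D. \<Sum>j\<in>batch_of d i - {i}. w j) = (\<Sum>d\<in>?D. \<Sum>j | j \<in> ?I \<and> j \<in> batch_of d i. w j)"
    proof (intro sum.cong refl)
      fix d assume d: "d \<in> ?D"
      show "batch_of d i - {i} = {j \<in> ?I. j \<in> batch_of d i}"
        using batch_of_subset(1)[OF batch_divisions_batches[OF d p] i] by auto
    qed
    also have "\<dots> = (\<Sum>j\<in>?I. \<Sum>d | d \<in> ?D \<and> j \<in> batch_of d i. w j)"
      by (rule sum.swap_restrict) (auto simp: finite_batch_divisions)
    also have "\<dots> = (\<Sum>j\<in>?I. real c *\<^sub>R w j)"
      using c by (intro sum.cong) (auto simp: sum_constant_scaleR)
    finally show ?thesis .
  qed
  note swap = this
  have "real (card ?D) * (real p - 1) = (\<Sum>d\<in>?D. \<Sum>j\<in>batch_of d i - {i}. 1)"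
  proof -
    have "(\<Sum>j\<in>batch_of d i - {i}. 1) = real p - 1" if d: "d \<in> ?D" for d
    proof -
      note b = batch_divisions_batches[OF d p]
      show ?thesis
        using batch_of_subset[OF b i] batch_of_mem(2)[of "{1..n*p}" d i] b i p
        by (simp add: batches_def of_nat_diff)
    qed
    then show ?thesis by simp
  qed
  also have "\<dots> = real c * (real (n * p) - 1)"
  proof -
    have "card ?I = n * p - 1" using i by (simp add: card_Diff_singleton)
    moreover have "real (n * p - 1) = real (n * p) - 1" using N2 of_nat_diff[of 1 "n * p"] by linarith
    ultimately show ?thesis unfolding swap by simp
  qed
  finally have cc: "real (card ?D) * (real p - 1) = real c * (real (n * p) - 1)" .
  have "real p - 1 > 0" "real (n * p) - 1 > 0" using p N2 by linarith+
  then have "real c / (real p - 1) = real (card ?D) / (real (n * p) - 1)"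
    using cc by (simp add: frac_eq_eq)
  then show ?thesis
    unfolding scaleR_sum_right[symmetric] swap
    by (simp add: scaleR_sum_right[symmetric] sum_constant_scaleR)
qed

section \<open>Interaction terms and Euler schemes\<close>

locale kernels =
  fixes N :: nat and m :: "nat \<Rightarrow> real"
    and K :: "nat \<Rightarrow> nat \<Rightarrow> (real ^ 'd) \<times> (real ^ 'd) \<Rightarrow> real ^ 'd" and A L :: real
  assumes weight: "j \<in> {1..N} \<Longrightarrow> 0 \<le> m j \<and> m j \<le> A"
    and K_bound: "i \<in> {1..N} \<Longrightarrow> j \<in> {1..N} \<Longrightarrow> norm (K i j z) \<le> L"
    and K_lipschitz: "i \<in> {1..N} \<Longrightarrow> j \<in> {1..N} \<Longrightarrow> norm (K i j z - K i j z') \<le> L * norm (z - z')"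
    and A_nonneg: "0 \<le> A" and L_nonneg: "0 \<le> L"
begin

definition interaction :: "nat set \<Rightarrow> nat \<Rightarrow> (nat \<Rightarrow> real ^ 'd) \<Rightarrow> real ^ 'd" where
  "interaction B i x = (1 / (real (card B) - 1)) *\<^sub>R (\<Sum>j\<in>B - {i}. m j *\<^sub>R K i j (x i, x j))"

lemma drift_eq: "drift f m K B i x = f (x i) + interaction B i x"
  by (simp add: drift_def interaction_def)

lemma weighted_mean_bound:
  assumes "B \<subseteq> {1..N}" "2 \<le> card B" and v: "\<And>j. j \<in> B - {i} \<Longrightarrow> norm (v j) \<le> w j"
  shows "norm ((1 / (real (card B) - 1)) *\<^sub>R (\<Sum>j\<in>B - {i}. m j *\<^sub>R (v j :: real ^ 'd)))
       \<le> A / (real (card B) - 1) * (\<Sum>j\<in>B - {i}. w j)"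
proof -
  have "norm (\<Sum>j\<in>B - {i}. m j *\<^sub>R v j) \<le> (\<Sum>j\<in>B - {i}. A * w j)"
  proof (rule sum_norm_le)
    fix j assume j: "j \<in> B - {i}"
    then have "0 \<le> m j" "m j \<le> A" using weight assms(1) by auto
    then show "norm (m j *\<^sub>R v j) \<le> A * w j"
      using v[OF j] A_nonneg by (simp add: mult_mono)
  qed
  then show ?thesis
    using assms(2) by (simp add: sum_distrib_left[symmetric] divide_right_mono)
qed

lemma interaction_bound:
  assumes B: "B \<subseteq> {1..N}" "i \<in> B" "2 \<le> card B"
  shows "norm (interaction B i x) \<le> A * L"
proof -
  have "norm (interaction B i x) \<le> A / (real (card B) - 1) * (\<Sum>j\<in>B - {i}. L)"
    unfolding interaction_def by (intro weighted_mean_bound K_bound) (use B in auto)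
  also have "\<dots> = A * L" using B by (simp add: card_Diff_singleton of_nat_diff)
  finally show ?thesis .
qed

lemma interaction_diff:
  assumes B: "B \<subseteq> {1..N}" "i \<in> B" "2 \<le> card B"
  shows "norm (interaction B i y - interaction B i x)
       \<le> A * L / (real (card B) - 1) * (\<Sum>j\<in>B - {i}. norm (y i - x i) + norm (y j - x j))"
proof -
  have eq: "interaction B i y - interaction B i x
      = (1 / (real (card B) - 1)) *\<^sub>R
          (\<Sum>j\<in>B - {i}. m j *\<^sub>R (K i j (y i, y j) - K i j (x i, x j)))"
    by (simp add: interaction_def scaleR_diff_right sum_subtractf)
  have "norm (interaction B i y - interaction B i x)
      \<le> A / (real (card B) - 1) * (\<Sum>j\<in>B - {i}. L * (norm (y i - x i) + norm (y j - x j)))"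
    unfolding eq
  proof (rule weighted_mean_bound)
    fix j assume "j \<in> B - {i}"
    then have "norm (K i j (y i, y j) - K i j (x i, x j)) \<le> L * norm ((y i, y j) - (x i, x j))"
      using B by (intro K_lipschitz) auto
    also have "\<dots> \<le> L * (norm (y i - x i) + norm (y j - x j))"
      using L_nonneg norm_Pair_le by (auto intro!: mult_left_mono)
    finally show "norm (K i j (y i, y j) - K i j (x i, x j)) \<le> L * (norm (y i - x i) + norm (y j - x j))" .
  qed (use B in auto)
  then show ?thesis by (simp add: sum_distrib_left[symmetric] mult.assoc)
qed

lemma interaction_lipschitz_sup:
  assumes B: "B \<subseteq> {1..N}" "i \<in> B" "2 \<le> card B"
    and e: "\<And>j. j \<in> {1..N} \<Longrightarrow> norm (y j - x j) \<le> e"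
  shows "norm (interaction B i y - interaction B i x) \<le> 2 * (A * L) * e"
proof -
  have "(\<Sum>j\<in>B - {i}. norm (y i - x i) + norm (y j - x j)) \<le> (\<Sum>j\<in>B - {i}. e + e)"
    using B by (intro sum_mono add_mono e) auto
  also have "\<dots> = (real (card B) - 1) * (2 * e)" using B by (simp add: card_Diff_singleton of_nat_diff)
  finally have "A * L / (real (card B) - 1) * (\<Sum>j\<in>B - {i}. norm (y i - x i) + norm (y j - x j))
      \<le> A * L / (real (card B) - 1) * ((real (card B) - 1) * (2 * e))"
    using B A_nonneg L_nonneg by (intro mult_left_mono divide_nonneg_nonneg) auto
  also have "\<dots> = 2 * (A * L) * e" using B by simp
  finally show ?thesis using interaction_diff[OF B, of y x] by linarith
qed

lemma batch_of_is_batch: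
  assumes "batches N p d" "i \<in> {1..N}"
  shows "batch_of d i \<subseteq> {1..N}" "i \<in> batch_of d i" "2 \<le> card (batch_of d i)"
  using batch_of_subset[OF assms] batch_of_mem(2)[of "{1..N}" d i] assms by (auto simp: batches_def)

text \<open>Summing over \<open>i\<close> frees the constant from \<open>p\<close>. Young's
  inequality leaves 3/2 of the particle's own square and 1/2 of each companion's, and
  \<open>sum_batch_others\<close> turns the latter into another 1/2 of the whole sum.\<close>

lemma sum_inner_interaction_diff:
  assumes d: "batches N p d"
  shows "(\<Sum>i=1..N. (y i - x i) \<bullet> (interaction (batch_of d i) i y - interaction (batch_of d i) i x))
       \<le> 2 * (A * L) * (\<Sum>i=1..N. (norm (y i - x i))\<^sup>2)"
proof -
  define z where "z i = norm (y i - x i)" for i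
  let ?a = "A * L / (real p - 1)"
  have p: "p \<ge> 2" using d by (simp add: batches_def)
  have a: "?a \<ge> 0" using A_nonneg L_nonneg p by simp
  have *: "(y i - x i) \<bullet> (interaction (batch_of d i) i y - interaction (batch_of d i) i x)
      \<le> 3 / 2 * (A * L) * (z i)\<^sup>2 + ?a / 2 * (\<Sum>j\<in>batch_of d i - {i}. (z j)\<^sup>2)" if i: "i \<in> {1..N}" for i
  proof -
    note B = batch_of_is_batch[OF d i] and c = batch_of_subset(2,3)[OF d i]
    have "(y i - x i) \<bullet> (interaction (batch_of d i) i y - interaction (batch_of d i) i x)
        \<le> z i * norm (interaction (batch_of d i) i y - interaction (batch_of d i) i x)"
      unfolding z_def by (rule norm_cauchy_schwarz)
    also have "\<dots> \<le> z i * (?a * (\<Sum>j\<in>batch_of d i - {i}. z i + z j))"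
      using interaction_diff[OF B, of y x] unfolding c(2) z_def[symmetric]
      by (intro mult_left_mono) (auto simp: z_def)
    also have "\<dots> = ?a * (\<Sum>j\<in>batch_of d i - {i}. z i * (z i + z j))"
      by (simp add: sum_distrib_left mult_ac)
    also have "\<dots> \<le> ?a * (\<Sum>j\<in>batch_of d i - {i}. 3 / 2 * (z i)\<^sup>2 + 1 / 2 * (z j)\<^sup>2)"
    proof (intro mult_left_mono sum_mono a)
      fix j
      show "z i * (z i + z j) \<le> 3 / 2 * (z i)\<^sup>2 + 1 / 2 * (z j)\<^sup>2"
        using zero_le_power2[of "z i - z j"] by (simp add: power2_eq_square algebra_simps)
    qed
    also have "(\<Sum>j\<in>batch_of d i - {i}. 3 / 2 * (z i)\<^sup>2 + 1 / 2 * (z j)\<^sup>2)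
        = (real p - 1) * (3 / 2 * (z i)\<^sup>2) + 1 / 2 * (\<Sum>j\<in>batch_of d i - {i}. (z j)\<^sup>2)"
      using B c p unfolding sum.distrib sum_distrib_left[symmetric]
      by (simp add: card_Diff_singleton of_nat_diff)
    also have "?a * \<dots> = 3 / 2 * (A * L) * (z i)\<^sup>2 + ?a / 2 * (\<Sum>j\<in>batch_of d i - {i}. (z j)\<^sup>2)"
      using p by (simp add: distrib_left)
    finally show ?thesis .
  qed
  have "(\<Sum>i=1..N. (y i - x i) \<bullet> (interaction (batch_of d i) i y - interaction (batch_of d i) i x))
      \<le> (\<Sum>i=1..N. 3 / 2 * (A * L) * (z i)\<^sup>2 + ?a / 2 * (\<Sum>j\<in>batch_of d i - {i}. (z j)\<^sup>2))"
    by (intro sum_mono *)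
  also have "\<dots> = 3 / 2 * (A * L) * (\<Sum>i=1..N. (z i)\<^sup>2)
      + ?a / 2 * ((real p - 1) * (\<Sum>i=1..N. (z i)\<^sup>2))"
    unfolding sum.distrib sum_distrib_left[symmetric] sum_batch_others[OF d] ..
  also have "?a / 2 * ((real p - 1) * (\<Sum>i=1..N. (z i)\<^sup>2)) = 1 / 2 * (A * L) * (\<Sum>i=1..N. (z i)\<^sup>2)"
  proof -
    have "c / q / 2 * (q * s) = 1 / 2 * c * s" if "q > 0" for c q s :: real
      using that by (simp add: field_simps)
    note * = this
    show ?thesis by (rule *) (use p in simp)
  qed
  finally show ?thesis by (simp add: z_def algebra_simps)
qed

definition fluctuation :: "nat set set \<Rightarrow> nat \<Rightarrow> (nat \<Rightarrow> real ^ 'd) \<Rightarrow> real ^ 'd" where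
  "fluctuation d i x = interaction (batch_of d i) i x - interaction {1..N} i x"

lemma fluctuation_bound:
  assumes "batches N p d" "i \<in> {1..N}" "2 \<le> N"
  shows "norm (fluctuation d i x) \<le> 2 * (A * L)"
  using norm_triangle_ineq4[of "interaction (batch_of d i) i x" "interaction {1..N} i x"]
    interaction_bound[OF batch_of_is_batch[OF assms(1,2)], of x]
    interaction_bound[of "{1..N}" i x] assms
  unfolding fluctuation_def by simp

text \<open>The configuration \<open>x\<close> is the same for every division in the sum. This is
  why the force must be evaluated at states that the current division has not influenced.\<close>

lemma sum_fluctuation:
  assumes "N = n * p" "2 \<le> p" "i \<in> {1..N}"
  shows "(\<Sum>d\<in>batch_divisions n p. fluctuation d i x) = 0"
proof -
  have "(\<Sum>d\<in>batch_divisions n p. interaction (batch_of d i) i x)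
      = (\<Sum>d\<in>batch_divisions n p. (1 / (real p - 1)) *\<^sub>R
           (\<Sum>j\<in>batch_of d i - {i}. m j *\<^sub>R K i j (x i, x j)))"
  proof (intro sum.cong refl)
    fix d assume "d \<in> batch_divisions n p"
    then show "interaction (batch_of d i) i x = (1 / (real p - 1)) *\<^sub>R
           (\<Sum>j\<in>batch_of d i - {i}. m j *\<^sub>R K i j (x i, x j))"
      using batch_of_subset(3)[OF batch_divisions_batches[of d n p]] assms by (simp add: interaction_def)
  qed
  also have "\<dots> = (\<Sum>d\<in>batch_divisions n p. interaction {1..N} i x)"
    using assms by (simp add: sum_batch_divisions interaction_def)
  finally show ?thesis by (simp add: fluctuation_def sum_subtractf)
qed

end

text \<open>With \<open>h * real l = \<tau>\<close> every step lies in a single period. The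
  one-sided constant is written \<open>\<kappa> - 1\<close> to leave room: by
  \<open>h * \<Lambda>\<^sup>2 \<le> 1\<close> the second-order term
  \<open>h\<^sup>2 * (norm (f x - f y))\<^sup>2\<close> is at most
  \<open>h * (norm (x - y))\<^sup>2\<close>, which the spare 1 absorbs.\<close>

locale euler_scheme = kernels N m K A L
  for N m and K :: "nat \<Rightarrow> nat \<Rightarrow> (real ^ 'd) \<times> (real ^ 'd) \<Rightarrow> real ^ 'd" and A L +
  fixes f :: "real ^ 'd \<Rightarrow> real ^ 'd" and \<kappa> \<Lambda> \<tau> h :: real and l :: nat
  assumes f_lipschitz: "norm (f x - f y) \<le> \<Lambda> * norm (x - y)"
    and f_one_sided: "(x - y) \<bullet> (f x - f y) \<le> (\<kappa> - 1) * (norm (x - y))\<^sup>2"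
    and kappa: "1 \<le> \<kappa>" and Lambda: "0 \<le> \<Lambda>" and l_pos: "0 < l"
    and h_pos: "0 < h" and h_l: "h * real l = \<tau>" and h_small: "h * \<Lambda>\<^sup>2 \<le> 1"
begin

text \<open>The increments \<open>g\<close> are arbitrary vectors and \<open>d\<close> is an
  arbitrary sequence, so the estimates are deterministic. In the difference of two schemes with the
  same \<open>g\<close> the noise cancels.\<close>

primrec euler :: "(nat \<Rightarrow> nat set set) \<Rightarrow> (nat \<Rightarrow> real ^ 'd) \<Rightarrow> (nat \<Rightarrow> nat \<Rightarrow> real ^ 'd)
    \<Rightarrow> nat \<Rightarrow> nat \<Rightarrow> real ^ 'd" where
  "euler d x0 g 0 = x0"
| "euler d x0 g (Suc j) = (\<lambda>i. euler d x0 g j i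
     + h *\<^sub>R drift f m K (batch_of (d (j div l)) i) i (euler d x0 g j) + g j i)"

lemma step_square: "(norm (u - v + h *\<^sub>R (f u - f v)))\<^sup>2 \<le> (1 + 2 * h * \<kappa>) * (norm (u - v))\<^sup>2"
proof -
  have "(norm (f u - f v))\<^sup>2 \<le> (\<Lambda> * norm (u - v))\<^sup>2"
    using f_lipschitz by (intro power_mono) auto
  then have "h\<^sup>2 * (norm (f u - f v))\<^sup>2 \<le> h\<^sup>2 * (\<Lambda> * norm (u - v))\<^sup>2"
    by (intro mult_left_mono) auto
  also have "\<dots> = h * (h * \<Lambda>\<^sup>2) * (norm (u - v))\<^sup>2"
    by (simp add: power2_eq_square)
  also have "\<dots> \<le> h * 1 * (norm (u - v))\<^sup>2"
    using h_small h_pos by (intro mult_right_mono mult_left_mono) auto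
  finally have 1: "h\<^sup>2 * (norm (f u - f v))\<^sup>2 \<le> h * (norm (u - v))\<^sup>2" by simp
  have 2: "2 * h * ((u - v) \<bullet> (f u - f v)) \<le> 2 * h * ((\<kappa> - 1) * (norm (u - v))\<^sup>2)"
    using h_pos f_one_sided by (intro mult_left_mono) auto
  have "(norm (s + h *\<^sub>R w))\<^sup>2 = (norm s)\<^sup>2 + 2 * h * (s \<bullet> w) + h\<^sup>2 * (norm w)\<^sup>2" for s w :: "real ^ 'd"
    unfolding power2_norm_eq_inner
    by (simp add: inner_add_left inner_add_right inner_commute power2_eq_square algebra_simps)
  then have "(norm (u - v + h *\<^sub>R (f u - f v)))\<^sup>2
      = (norm (u - v))\<^sup>2 + 2 * h * ((u - v) \<bullet> (f u - f v)) + h\<^sup>2 * (norm (f u - f v))\<^sup>2" .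
  also have "\<dots> \<le> (norm (u - v))\<^sup>2 + 2 * h * ((\<kappa> - 1) * (norm (u - v))\<^sup>2) + h * (norm (u - v))\<^sup>2"
    using 1 2 by linarith
  also have "\<dots> = (1 + 2 * h * \<kappa> - h) * (norm (u - v))\<^sup>2" by (simp add: algebra_simps)
  also have "\<dots> \<le> (1 + 2 * h * \<kappa>) * (norm (u - v))\<^sup>2" using h_pos by (intro mult_right_mono) auto
  finally show ?thesis .
qed

lemma step_norm: "norm (u - v + h *\<^sub>R (f u - f v)) \<le> (1 + h * \<kappa>) * norm (u - v)"
proof (rule power2_le_imp_le)
  have "(1 + 2 * h * \<kappa>) * (norm (u - v))\<^sup>2 \<le> (1 + h * \<kappa>)\<^sup>2 * (norm (u - v))\<^sup>2"
    using h_pos kappa by (intro mult_right_mono) (auto simp: power2_eq_square algebra_simps)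
  then show "(norm (u - v + h *\<^sub>R (f u - f v)))\<^sup>2 \<le> ((1 + h * \<kappa>) * norm (u - v))\<^sup>2"
    using step_square[of u v] by (simp add: power_mult_distrib)
  show "0 \<le> (1 + h * \<kappa>) * norm (u - v)" using h_pos kappa by simp
qed

lemma power_le_exp: "0 \<le> c \<Longrightarrow> (1 + h * c) ^ j \<le> exp (c * (h * real j))"
proof -
  assume "0 \<le> c"
  then have "(1 + h * c) ^ j \<le> exp (h * c) ^ j"
    using h_pos by (intro power_mono) (auto intro: add_nonneg_nonneg)
  also have "\<dots> = exp (c * (h * real j))" by (simp add: exp_of_nat_mult[symmetric] algebra_simps)
  finally show ?thesis .
qed

text \<open>Step \<open>Suc j\<close> reads division \<open>j div l\<close>, so the state at
  \<open>q * l\<close>, the start of period \<open>q\<close>, has not yet seen division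
  \<open>q\<close>.\<close>

lemma euler_cong:
  assumes "\<And>k. k < q \<Longrightarrow> d k = d' k" "j \<le> q * l"
  shows "euler d x0 g j = euler d' x0 g j"
  using assms(2)
proof (induction j)
  case (Suc j)
  then have "j div l < q" by (intro less_mult_imp_div_less) simp
  then show ?case using Suc assms(1) by simp
qed simp

text \<open>Both schemes share the state at \<open>q * l\<close>. From there on the two interactions
  differ by at most \<open>2 * (A * L)\<close> because each is bounded, so a particle is estimated
  on its own, without coupling to the others; \<open>step_norm\<close> propagates the difference. As
  \<open>r \<le> l\<close>, no division after \<open>q\<close> has been read.\<close>

lemma euler_change:
  assumes agree: "\<And>k. k < q \<Longrightarrow> d k = d' k" and b: "batches N p (d q)" "batches N p (d' q)"
    and i: "i \<in> {1..N}" and "r \<le> l"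
  shows "norm (euler d x0 g (q * l + r) i - euler d' x0 g (q * l + r) i)
       \<le> 2 * (A * L) * h * real r * (1 + h * \<kappa>) ^ r"
  using \<open>r \<le> l\<close>
proof (induction r)
  case 0
  then show ?case using euler_cong[of q d d' "q * l"] agree by simp
next
  case (Suc r)
  let ?j = "q * l + r" and ?a = "2 * (A * L)"
  let ?y = "euler d x0 g ?j" and ?x = "euler d' x0 g ?j"
  have q: "?j div l = q" using Suc.prems by simp
  have pos: "0 \<le> 1 + h * \<kappa>" "1 \<le> 1 + h * \<kappa>" using h_pos kappa by simp_all
  have IH: "norm (?y i - ?x i) \<le> ?a * h * real r * (1 + h * \<kappa>) ^ r"
    by (rule Suc.IH) (use Suc.prems in simp)
  have w: "norm (interaction (batch_of (d q) i) i ?y - interaction (batch_of (d' q) i) i ?x) \<le> ?a"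
    using norm_triangle_ineq4[of "interaction (batch_of (d q) i) i ?y" "interaction (batch_of (d' q) i) i ?x"]
      interaction_bound[OF batch_of_is_batch[OF b(1) i], of ?y]
      interaction_bound[OF batch_of_is_batch[OF b(2) i], of ?x] by linarith
  have eq: "euler d x0 g (q * l + Suc r) i - euler d' x0 g (q * l + Suc r) i
      = (?y i - ?x i + h *\<^sub>R (f (?y i) - f (?x i)))
        + h *\<^sub>R (interaction (batch_of (d q) i) i ?y - interaction (batch_of (d' q) i) i ?x)"
    by (simp only: add_Suc_right euler.simps q drift_eq) (simp add: algebra_simps)
  have "norm (euler d x0 g (q * l + Suc r) i - euler d' x0 g (q * l + Suc r) i)
      \<le> (1 + h * \<kappa>) * norm (?y i - ?x i) + h * ?a"
    unfolding eq using h_pos w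
    by (intro norm_triangle_mono step_norm) auto
  also have "\<dots> \<le> (1 + h * \<kappa>) * (?a * h * real r * (1 + h * \<kappa>) ^ r) + h * ?a"
    by (rule add_right_mono[OF mult_left_mono[OF IH pos(1)]])
  also have "\<dots> = ?a * h * real r * (1 + h * \<kappa>) ^ Suc r + ?a * h * 1" by (simp add: algebra_simps)
  also have "\<dots> \<le> ?a * h * real r * (1 + h * \<kappa>) ^ Suc r + ?a * h * (1 + h * \<kappa>) ^ Suc r"
    using h_pos A_nonneg L_nonneg pos by (intro add_left_mono mult_left_mono one_le_power) auto
  also have "\<dots> = ?a * h * real (Suc r) * (1 + h * \<kappa>) ^ Suc r" by (simp add: algebra_simps)
  finally show ?case .
qed

text \<open>Origin of the constants: \<open>2 * \<kappa>\<close> comes from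
  \<open>step_square\<close>, the 1 from the product of the difference of \<open>f\<close> with the
  force difference (by \<open>h * \<Lambda>\<^sup>2 \<le> 1\<close>), and \<open>4 * (A * L)\<close>
  is twice the constant of \<open>sum_inner_interaction_diff\<close>. The squared force difference,
  at most \<open>4 * (A * L)\<^sup>2\<close>, is counted twice, once directly and once from that
  product.\<close>

lemma error_step:
  fixes x0 g
  defines "x \<equiv> euler (\<lambda>_. {{1..N}}) x0 g"
  assumes b: "batches N p (d (j div l))" and "2 \<le> N"
  shows "(\<Sum>i=1..N. (norm (euler d x0 g (Suc j) i - x (Suc j) i))\<^sup>2)
    \<le> (1 + h * (2 * \<kappa> + 1 + 4 * (A * L))) * (\<Sum>i=1..N. (norm (euler d x0 g j i - x j i))\<^sup>2)
      + 2 * h * (\<Sum>i=1..N. (euler d x0 g j i - x j i) \<bullet> fluctuation (d (j div l)) i (x j))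
      + 8 * h\<^sup>2 * (A * L)\<^sup>2 * real N"
proof -
  define y where "y = euler d x0 g j"
  define e where "e = d (j div l)"
  let ?a = "A * L"
  define w where "w i = interaction (batch_of e i) i y - interaction {1..N} i (x j)" for i
  have e: "batches N p e" using b by (simp add: e_def)
  have full: "batch_of {{1..N}} i = {1..N}" if "i \<in> {1..N}" for i
    by (rule batch_of_eq[of "{1..N}"]) (use that in \<open>auto simp: partition_on_def\<close>)
  have one: "(norm (euler d x0 g (Suc j) i - x (Suc j) i))\<^sup>2
      \<le> (1 + h * (2 * \<kappa> + 1)) * (norm (y i - x j i))\<^sup>2 + 2 * h * ((y i - x j i) \<bullet> w i) + 8 * h\<^sup>2 * ?a\<^sup>2"
    if i: "i \<in> {1..N}" for i
  proof -
    let ?z = "y i - x j i" and ?D = "f (y i) - f (x j i)"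
    have w: "norm (w i) \<le> 2 * ?a"
      using norm_triangle_ineq4[of "interaction (batch_of e i) i y" "interaction {1..N} i (x j)"]
        interaction_bound[OF batch_of_is_batch[OF e i], of y]
        interaction_bound[of "{1..N}" i "x j"] i \<open>2 \<le> N\<close> unfolding w_def by simp
    have "euler d x0 g (Suc j) i - x (Suc j) i = ?z + h *\<^sub>R ?D + h *\<^sub>R w i"
      by (simp only: x_def euler.simps y_def[symmetric] e_def[symmetric] full[OF i] w_def drift_eq)
        (simp add: algebra_simps)
    moreover have "(norm (z + h *\<^sub>R D + h *\<^sub>R v))\<^sup>2
        = (norm (z + h *\<^sub>R D))\<^sup>2 + 2 * h * (z \<bullet> v) + 2 * h\<^sup>2 * (D \<bullet> v) + h\<^sup>2 * (norm v)\<^sup>2"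
      for z D v :: "real ^ 'd"
      unfolding power2_norm_eq_inner
      by (simp add: inner_add_left inner_add_right inner_commute power2_eq_square algebra_simps)
    ultimately have eq: "(norm (euler d x0 g (Suc j) i - x (Suc j) i))\<^sup>2
        = (norm (?z + h *\<^sub>R ?D))\<^sup>2 + 2 * h * (?z \<bullet> w i) + 2 * h\<^sup>2 * (?D \<bullet> w i) + h\<^sup>2 * (norm (w i))\<^sup>2"
      by simp
    have "?D \<bullet> w i \<le> norm ?D * norm (w i)" by (rule norm_cauchy_schwarz)
    also have "\<dots> \<le> (\<Lambda> * norm ?z) * norm (w i)"
      using f_lipschitz by (intro mult_right_mono) auto
    finally have "2 * (?D \<bullet> w i) \<le> (\<Lambda> * norm ?z)\<^sup>2 + (norm (w i))\<^sup>2"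
      using zero_le_power2[of "\<Lambda> * norm ?z - norm (w i)"] by (simp add: power2_eq_square algebra_simps)
    then have "h\<^sup>2 * (2 * (?D \<bullet> w i)) \<le> h\<^sup>2 * ((\<Lambda> * norm ?z)\<^sup>2 + (norm (w i))\<^sup>2)"
      by (intro mult_left_mono) auto
    also have "\<dots> = h * (h * \<Lambda>\<^sup>2) * (norm ?z)\<^sup>2 + h\<^sup>2 * (norm (w i))\<^sup>2"
      by (simp add: power2_eq_square algebra_simps)
    also have "\<dots> \<le> h * 1 * (norm ?z)\<^sup>2 + h\<^sup>2 * (norm (w i))\<^sup>2"
      using h_small h_pos by (intro add_right_mono mult_right_mono mult_left_mono) auto
    finally have cross: "2 * h\<^sup>2 * (?D \<bullet> w i) \<le> h * (norm ?z)\<^sup>2 + h\<^sup>2 * (norm (w i))\<^sup>2" by simp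
    have "(norm (w i))\<^sup>2 \<le> (2 * ?a)\<^sup>2" using w by (intro power_mono) auto
    then have "h\<^sup>2 * (norm (w i))\<^sup>2 \<le> h\<^sup>2 * (2 * ?a)\<^sup>2" by (intro mult_left_mono) auto
    also have "\<dots> = 4 * h\<^sup>2 * ?a\<^sup>2" by (simp only: power_mult_distrib) simp
    finally have ww: "h\<^sup>2 * (norm (w i))\<^sup>2 \<le> 4 * h\<^sup>2 * ?a\<^sup>2" .
    have "(1 + h * (2 * \<kappa> + 1)) * (norm ?z)\<^sup>2 = (1 + 2 * h * \<kappa>) * (norm ?z)\<^sup>2 + h * (norm ?z)\<^sup>2"
      by (simp add: algebra_simps)
    then show ?thesis
      unfolding eq using step_square[of "y i" "x j i"] cross ww by linarith
  qed
  define Z where "Z = (\<Sum>i=1..N. (norm (y i - x j i))\<^sup>2)"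
  define F where "F = (\<Sum>i=1..N. (y i - x j i) \<bullet> fluctuation e i (x j))"
  define I where
    "I = (\<Sum>i=1..N. (y i - x j i) \<bullet> (interaction (batch_of e i) i y - interaction (batch_of e i) i (x j)))"
  have "(\<Sum>i=1..N. (norm (euler d x0 g (Suc j) i - x (Suc j) i))\<^sup>2)
      \<le> (\<Sum>i=1..N. (1 + h * (2 * \<kappa> + 1)) * (norm (y i - x j i))\<^sup>2
            + 2 * h * ((y i - x j i) \<bullet> w i) + 8 * h\<^sup>2 * ?a\<^sup>2)"
    by (intro sum_mono one)
  also have "\<dots> = (1 + h * (2 * \<kappa> + 1)) * Z
      + 2 * h * (\<Sum>i=1..N. (y i - x j i) \<bullet> w i) + 8 * h\<^sup>2 * ?a\<^sup>2 * real N"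
    unfolding sum.distrib sum_distrib_left[symmetric] Z_def by simp
  \<comment> \<open>The batch force at \<open>x j\<close> is added and subtracted. \<open>I\<close>
    compares one force at two configurations and is quadratic in the error; \<open>F\<close>
    compares two forces at \<open>x j\<close>, which does not depend on \<open>d\<close>.\<close>
  also have "(\<Sum>i=1..N. (y i - x j i) \<bullet> w i) = I + F"
    unfolding I_def F_def sum.distrib[symmetric] inner_add_right[symmetric] w_def fluctuation_def by simp
  finally have 1: "(\<Sum>i=1..N. (norm (euler d x0 g (Suc j) i - x (Suc j) i))\<^sup>2)
      \<le> (1 + h * (2 * \<kappa> + 1)) * Z + 2 * h * (I + F) + 8 * h\<^sup>2 * ?a\<^sup>2 * real N" .
  have "2 * h * I \<le> 2 * h * (2 * ?a * Z)"
    unfolding I_def Z_def using h_pos by (intro mult_left_mono sum_inner_interaction_diff[OF e]) auto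
  then have "(1 + h * (2 * \<kappa> + 1)) * Z + 2 * h * (I + F)
      \<le> (1 + h * (2 * \<kappa> + 1 + 4 * ?a)) * Z + 2 * h * F"
    by (simp add: algebra_simps)
  then show ?thesis
    using 1 unfolding Z_def F_def y_def e_def by linarith
qed

end

section \<open>Averaging the scheme error over sequences of divisions\<close>

lemma sum_PiE_update:
  assumes "q \<in> I"
  shows "(\<Sum>d\<in>PiE I T. F d) = (\<Sum>g\<in>PiE (I - {q}) T. \<Sum>c\<in>T q. F (g(q := c)))"
proof -
  have I: "insert q (I - {q}) = I" using assms by auto
  have "(\<Sum>d\<in>PiE I T. F d) = (\<Sum>(c, g)\<in>T q \<times> PiE (I - {q}) T. F (g(q := c)))"
    using sum.reindex[OF inj_combinator[of q "I - {q}" T], of F]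
    unfolding PiE_insert_eq[of q "I - {q}" T, unfolded I] by (simp add: o_def case_prod_unfold)
  also have "\<dots> = (\<Sum>c\<in>T q. \<Sum>g\<in>PiE (I - {q}) T. F (g(q := c)))"
    by (rule sum.cartesian_product[symmetric])
  also have "\<dots> = (\<Sum>g\<in>PiE (I - {q}) T. \<Sum>c\<in>T q. F (g(q := c)))"
    by (rule sum.swap)
  finally show ?thesis .
qed

lemma continuous_on_of_lipschitz:
  assumes "0 \<le> L" "\<And>x y. norm (f x - f y) \<le> L * norm (x - y)"
  shows "continuous_on UNIV f"
  using lipschitz_on_continuous_on[of L UNIV f] assms by (simp add: lipschitz_on_def dist_norm)

context euler_scheme
begin

text \<open>
  Redrawing only the division of the current period moves the scheme by \<open>O(\<tau>)\<close>, while the redrawn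
  scheme is independent of the fluctuation, which averages to zero.
\<close>

lemma sum_inner_fluctuation:
  fixes x :: "nat \<Rightarrow> real ^ 'd"
  assumes N: "N = n * p" "2 \<le> p" "2 \<le> N" and i: "i \<in> {1..N}"
    and q: "j div l < Q" and T: "h * real j \<le> T"
  defines "S \<equiv> {..<Q} \<rightarrow>\<^sub>E batch_divisions n p"
  shows "(\<Sum>d\<in>S. (euler d x0 g j i - x i) \<bullet> fluctuation (d (j div l)) i x)
       \<le> real (card S) * (4 * (A * L)\<^sup>2 * \<tau> * exp (\<kappa> * T))"
proof -
  define q where "q = j div l"
  define r where "r = j mod l"
  let ?D = "batch_divisions n p" and ?S' = "({..<Q} - {q}) \<rightarrow>\<^sub>E batch_divisions n p"
  let ?B = "4 * (A * L)\<^sup>2 * \<tau> * exp (\<kappa> * T)"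
  have q: "q \<in> {..<Q}" using q by (simp add: q_def)
  have r: "r \<le> l" "j = q * l + r" using l_pos by (auto simp: r_def q_def)
  have tau: "0 < \<tau>" using h_pos h_l l_pos by (metis mult_pos_pos of_nat_0_less_iff)
  have b: "batches N p e" if "e \<in> ?D" for e
    using batch_divisions_batches[OF that \<open>2 \<le> p\<close>] N by simp
  have inner: "(\<Sum>c\<in>?D. (euler (d(q := c)) x0 g j i - x i) \<bullet> fluctuation c i x) \<le> real (card ?D) * ?B"
    if d: "d \<in> ?S'" for d
  proof (cases "?D = {}")
    case False
    \<comment> \<open>An arbitrary reference division for the current period: \<open>?y e\<close>
      does not involve \<open>c\<close>, and \<open>euler_change\<close> keeps it within order
      \<open>\<tau>\<close> of \<open>?y c\<close>.\<close>
    then obtain e where e: "e \<in> ?D" by blast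
    let ?y = "\<lambda>c. euler (d(q := c)) x0 g j i"
    have "(?y c - ?y e) \<bullet> fluctuation c i x \<le> ?B" if c: "c \<in> ?D" for c
    proof -
      have "norm (?y c - ?y e) \<le> 2 * (A * L) * h * real r * (1 + h * \<kappa>) ^ r"
        unfolding r(2) by (rule euler_change) (use r b c e i in auto)
      also have "\<dots> = 2 * (A * L) * (h * real r) * (1 + h * \<kappa>) ^ r" by simp
      also have "\<dots> \<le> 2 * (A * L) * \<tau> * exp (\<kappa> * T)"
      proof (intro mult_mono)
        show "h * real r \<le> \<tau>" using r h_pos unfolding h_l[symmetric] by simp
        have "h * real r \<le> h * real j" using r(2) h_pos by simp
        then have "\<kappa> * (h * real r) \<le> \<kappa> * T" using T kappa by (intro mult_left_mono) auto
        then show "(1 + h * \<kappa>) ^ r \<le> exp (\<kappa> * T)"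
          using power_le_exp[of \<kappa> r] kappa by (meson exp_le_cancel_iff order_trans zero_le_one)
      qed (use A_nonneg L_nonneg h_pos tau kappa in auto)
      finally have "norm (?y c - ?y e) \<le> 2 * (A * L) * \<tau> * exp (\<kappa> * T)" .
      then have "norm (?y c - ?y e) * norm (fluctuation c i x)
          \<le> (2 * (A * L) * \<tau> * exp (\<kappa> * T)) * (2 * (A * L))"
        using fluctuation_bound[OF b[OF c] i \<open>2 \<le> N\<close>] A_nonneg L_nonneg tau
        by (intro mult_mono) auto
      also have "\<dots> = ?B" by (simp add: power2_eq_square algebra_simps)
      finally show ?thesis using norm_cauchy_schwarz order_trans by blast
    qed
    then have "(\<Sum>c\<in>?D. (?y c - ?y e) \<bullet> fluctuation c i x) \<le> real (card ?D) * ?B"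
      by (rule sum_bounded_above)
    \<comment> \<open>The left factor is constant in \<open>c\<close>, so the sum falls on the
      fluctuation alone.\<close>
    moreover have "(\<Sum>c\<in>?D. (?y e - x i) \<bullet> fluctuation c i x) = 0"
      using sum_fluctuation[OF N(1,2) i, of x] by (simp add: inner_sum_right[symmetric])
    moreover have "(\<Sum>c\<in>?D. (?y c - x i) \<bullet> fluctuation c i x)
        = (\<Sum>c\<in>?D. (?y c - ?y e) \<bullet> fluctuation c i x) + (\<Sum>c\<in>?D. (?y e - x i) \<bullet> fluctuation c i x)"
      unfolding sum.distrib[symmetric] inner_add_left[symmetric] by simp
    ultimately show ?thesis by simp
  qed simp
  have card: "real (card S) = (\<Sum>d\<in>?S'. real (card ?D))"
    using sum_PiE_update[OF q, where T = "\<lambda>_. ?D" and F = "\<lambda>_. 1 :: real"] by (simp add: S_def)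
  have "(\<Sum>d\<in>S. (euler d x0 g j i - x i) \<bullet> fluctuation (d q) i x)
      = (\<Sum>d\<in>?S'. \<Sum>c\<in>?D. (euler (d(q := c)) x0 g j i - x i) \<bullet> fluctuation c i x)"
    unfolding S_def sum_PiE_update[OF q] by simp
  also have "\<dots> \<le> (\<Sum>d\<in>?S'. real (card ?D) * ?B)" by (intro sum_mono inner)
  also have "\<dots> = real (card S) * ?B" unfolding card by (simp add: sum_distrib_right)
  finally show ?thesis unfolding q_def .
qed

text \<open>Initial data and noise are frozen, and \<open>S\<close> replaces the expectation over
  divisions. \<open>sum_inner_fluctuation\<close> applies because \<open>x\<close>, the full scheme,
  reads no drawn division. Its contribution is the summand with \<open>exp (\<kappa> * T)\<close>;
  the remaining \<open>8 * a\<^sup>2\<close> is the quadratic remainder of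
  \<open>error_step\<close>, in which one factor \<open>h\<close> is bounded by
  \<open>\<tau>\<close>.\<close>

lemma mean_square_error:
  fixes x0 :: "nat \<Rightarrow> real ^ 'd" and g :: "nat \<Rightarrow> nat \<Rightarrow> real ^ 'd"
  assumes N: "N = n * p" "2 \<le> p" "2 \<le> N" and T: "h * real j \<le> T" and "j \<le> Q * l"
  defines "S \<equiv> {..<Q} \<rightarrow>\<^sub>E batch_divisions n p"
    and "x \<equiv> euler (\<lambda>_. {{1..N}}) x0 g" and "a \<equiv> A * L"
  shows "(\<Sum>d\<in>S. \<Sum>i=1..N. (norm (euler d x0 g j i - x j i))\<^sup>2)
       \<le> T * exp ((2 * \<kappa> + 1 + 4 * a) * T) * (8 * a\<^sup>2 * (exp (\<kappa> * T) + 1)) * \<tau> * (real (card S) * real N)"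
proof -
  define c where "c = 2 * \<kappa> + 1 + 4 * a"
  define E where "E = exp (\<kappa> * T)"
  define G where "G = 8 * a\<^sup>2 * (E + 1) * \<tau> * (real (card S) * real N)"
  define U where "U j = (\<Sum>d\<in>S. \<Sum>i=1..N. (norm (euler d x0 g j i - x j i))\<^sup>2)" for j
  have tau: "0 < \<tau>" using h_pos h_l l_pos by (metis mult_pos_pos of_nat_0_less_iff)
  have "h * 1 \<le> h * real l" using h_pos l_pos by (intro mult_left_mono) auto
  then have h_tau: "h \<le> \<tau>" by (simp add: h_l)
  have a: "0 \<le> a" using A_nonneg L_nonneg by (simp add: a_def)
  have c: "0 \<le> c" using a kappa by (simp add: c_def)
  have G: "0 \<le> G" using tau by (auto simp: G_def E_def intro!: mult_nonneg_nonneg add_nonneg_nonneg)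
  have step: "U (Suc j) \<le> (1 + h * c) * U j + h * G" if j: "j div l < Q" "h * real j \<le> T" for j
  proof -
    have "U (Suc j) \<le> (\<Sum>d\<in>S. (1 + h * c) * (\<Sum>i=1..N. (norm (euler d x0 g j i - x j i))\<^sup>2)
        + 2 * h * (\<Sum>i=1..N. (euler d x0 g j i - x j i) \<bullet> fluctuation (d (j div l)) i (x j))
        + 8 * h\<^sup>2 * a\<^sup>2 * real N)"
      unfolding U_def x_def c_def a_def
    proof (intro sum_mono error_step)
      fix d assume "d \<in> S"
      then have "d (j div l) \<in> batch_divisions n p" using j by (auto simp: S_def)
      then show "batches N p (d (j div l))" using batch_divisions_batches N by blast
    qed (rule \<open>2 \<le> N\<close>)
    also have "\<dots> = (1 + h * c) * U j
        + 2 * h * (\<Sum>d\<in>S. \<Sum>i=1..N. (euler d x0 g j i - x j i) \<bullet> fluctuation (d (j div l)) i (x j))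
        + real (card S) * (8 * h\<^sup>2 * a\<^sup>2 * real N)"
      unfolding sum.distrib sum_distrib_left[symmetric] U_def by simp
    also have "(\<Sum>d\<in>S. \<Sum>i=1..N. (euler d x0 g j i - x j i) \<bullet> fluctuation (d (j div l)) i (x j))
        = (\<Sum>i=1..N. \<Sum>d\<in>S. (euler d x0 g j i - x j i) \<bullet> fluctuation (d (j div l)) i (x j))"
      by (rule sum.swap)
    finally have 1: "U (Suc j) \<le> (1 + h * c) * U j
        + 2 * h * (\<Sum>i=1..N. \<Sum>d\<in>S. (euler d x0 g j i - x j i) \<bullet> fluctuation (d (j div l)) i (x j))
        + real (card S) * (8 * h\<^sup>2 * a\<^sup>2 * real N)" .
    have "(\<Sum>i=1..N. \<Sum>d\<in>S. (euler d x0 g j i - x j i) \<bullet> fluctuation (d (j div l)) i (x j))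
        \<le> (\<Sum>i=1..N. real (card S) * (4 * a\<^sup>2 * \<tau> * E))"
      unfolding S_def E_def a_def by (intro sum_mono sum_inner_fluctuation N j) auto
    then have "2 * h * (\<Sum>i=1..N. \<Sum>d\<in>S. (euler d x0 g j i - x j i) \<bullet> fluctuation (d (j div l)) i (x j))
        \<le> 2 * h * (real N * (real (card S) * (4 * a\<^sup>2 * \<tau> * E)))"
      using h_pos by (intro mult_left_mono) auto
    moreover have "real (card S) * (8 * h\<^sup>2 * a\<^sup>2 * real N) \<le> h * (8 * a\<^sup>2 * \<tau> * (real (card S) * real N))"
    proof -
      have "(8 * h * a\<^sup>2 * real (card S) * real N) * h \<le> (8 * h * a\<^sup>2 * real (card S) * real N) * \<tau>"
        using h_tau h_pos by (intro mult_left_mono) auto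
      then show ?thesis by (simp add: power2_eq_square mult_ac)
    qed
    moreover have "h * G = 2 * h * (real N * (real (card S) * (4 * a\<^sup>2 * \<tau> * E)))
        + h * (8 * a\<^sup>2 * \<tau> * (real (card S) * real N))"
      by (simp add: G_def algebra_simps)
    ultimately show ?thesis using 1 by linarith
  qed
  \<comment> \<open>Discrete Gronwall: starting from 0, each step multiplies by
    \<open>1 + h * c\<close> and adds \<open>h * G\<close>, so there are \<open>j\<close>
    contributions, each inflated by at most the full power.\<close>
  have "U j \<le> h * real j * (1 + h * c) ^ j * G" if "j \<le> Q * l" "h * real j \<le> T" for j
    using that
  proof (induction j)
    case 0
    then show ?case by (simp add: U_def x_def)
  next
    case (Suc j)
    have j: "j div l < Q" "h * real j \<le> T"
      using Suc.prems h_pos by (auto intro!: less_mult_imp_div_less simp: distrib_left)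
    have pos: "0 \<le> 1 + h * c" "1 \<le> 1 + h * c" using h_pos c by simp_all
    have IH: "U j \<le> h * real j * (1 + h * c) ^ j * G" using Suc.IH Suc.prems(1) j(2) by simp
    have "U (Suc j) \<le> (1 + h * c) * U j + h * G * 1" using step[OF j] by simp
    also have "\<dots> \<le> (1 + h * c) * (h * real j * (1 + h * c) ^ j * G) + h * G * (1 + h * c) ^ Suc j"
      by (intro add_mono mult_left_mono IH one_le_power) (use pos h_pos G in auto)
    also have "\<dots> = h * real (Suc j) * (1 + h * c) ^ Suc j * G" by (simp add: algebra_simps)
    finally show ?case .
  qed
  then have "U j \<le> h * real j * (1 + h * c) ^ j * G" using assms by simp
  also have "\<dots> \<le> T * exp (c * T) * G"
  proof (intro mult_right_mono mult_mono T)
    have "c * (h * real j) \<le> c * T" using T c by (intro mult_left_mono) auto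
    then show "(1 + h * c) ^ j \<le> exp (c * T)"
      using power_le_exp[OF c, of j] by (meson exp_le_cancel_iff order_trans)
    show "0 \<le> T" using T h_pos by (meson less_imp_le mult_nonneg_nonneg of_nat_0_le_iff order_trans)
  qed (use h_pos c G in auto)
  finally show ?thesis by (simp add: U_def G_def c_def E_def mult_ac)
qed

lemma measurable_interaction:
  assumes B: "B \<subseteq> {1..N}" "i \<in> {1..N}"
    and u: "\<And>j. j \<in> {1..N} \<Longrightarrow> (\<lambda>\<omega>. u \<omega> j) \<in> borel_measurable M"
  shows "(\<lambda>\<omega>. interaction B i (u \<omega>)) \<in> borel_measurable M"
  unfolding interaction_def
proof (intro borel_measurable_scaleR borel_measurable_sum borel_measurable_const)
  fix j assume j: "j \<in> B - {i}"
  have "K i j \<in> borel_measurable borel"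
    using j B K_lipschitz L_nonneg
    by (intro borel_measurable_continuous_onI continuous_on_of_lipschitz[of L]) auto
  moreover have "(\<lambda>\<omega>. (u \<omega> i, u \<omega> j)) \<in> borel_measurable M"
    using j B u by (intro borel_measurable_Pair) auto
  ultimately show "(\<lambda>\<omega>. K i j (u \<omega> i, u \<omega> j)) \<in> borel_measurable M"
    by (rule measurable_compose[rotated])
qed

text \<open>\<open>M\<close> is left open since it will be the algebra of initial data and noise,
  with \<open>d\<close> a fixed sequence: measurability there is what independence of the divisions
  acts on.\<close>

lemma measurable_euler:
  assumes b: "\<And>k. k < Q \<Longrightarrow> batches N p (d k)"
    and x0: "\<And>i. i \<in> {1..N} \<Longrightarrow> (\<lambda>\<omega>. x0 \<omega> i) \<in> borel_measurable M"
    and g: "\<And>j i. i \<in> {1..N} \<Longrightarrow> (\<lambda>\<omega>. g \<omega> j i) \<in> borel_measurable M"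
  shows "j \<le> Q * l \<Longrightarrow> i \<in> {1..N} \<Longrightarrow> (\<lambda>\<omega>. euler d (x0 \<omega>) (g \<omega>) j i) \<in> borel_measurable M"
proof (induction j arbitrary: i)
  case 0
  then show ?case using x0 by simp
next
  case (Suc j)
  have q: "j div l < Q" using Suc by (intro less_mult_imp_div_less) simp
  have IH: "(\<lambda>\<omega>. euler d (x0 \<omega>) (g \<omega>) j i) \<in> borel_measurable M" if "i \<in> {1..N}" for i
    using Suc that by simp
  have "f \<in> borel_measurable borel"
    using f_lipschitz Lambda
    by (intro borel_measurable_continuous_onI continuous_on_of_lipschitz[of \<Lambda>]) auto
  then have "(\<lambda>\<omega>. f (euler d (x0 \<omega>) (g \<omega>) j i)) \<in> borel_measurable M"
    using IH[OF Suc.prems(2)] by (rule measurable_compose[rotated])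
  moreover have "(\<lambda>\<omega>. interaction (batch_of (d (j div l)) i) i (euler d (x0 \<omega>) (g \<omega>) j)) \<in> borel_measurable M"
    using Suc.prems IH batch_of_is_batch(1)[OF b[OF q]] by (intro measurable_interaction) auto
  ultimately show ?case
    using IH g Suc.prems(2) unfolding euler.simps drift_eq
    by (intro borel_measurable_add borel_measurable_scaleR borel_measurable_const) auto
qed

end

section \<open>Convergence of the Euler schemes\<close>

text \<open>
  Covers both systems: the full one is the case of the single batch \<open>{1..N}\<close> in every period. The noise
  \<open>w\<close> already contains the factor \<open>\<sigma>\<close>.
\<close>

definition solves_batch_system ::
    "real \<Rightarrow> real \<Rightarrow> nat \<Rightarrow> (real ^ 'd \<Rightarrow> real ^ 'd) \<Rightarrow> (nat \<Rightarrow> real)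
      \<Rightarrow> (nat \<Rightarrow> nat \<Rightarrow> (real ^ 'd) \<times> (real ^ 'd) \<Rightarrow> real ^ 'd) \<Rightarrow> (nat \<Rightarrow> nat set set)
      \<Rightarrow> (nat \<Rightarrow> real ^ 'd) \<Rightarrow> (real \<Rightarrow> nat \<Rightarrow> real ^ 'd) \<Rightarrow> (real \<Rightarrow> nat \<Rightarrow> real ^ 'd) \<Rightarrow> bool" where
  "solves_batch_system T \<tau> N b m K d x0 w y \<longleftrightarrow>
     (\<forall>i\<in>{1..N}. continuous_on {0..T} (\<lambda>t. y t i) \<and> y 0 i = x0 i) \<and>
     (\<forall>k. \<forall>i\<in>{1..N}. \<forall>t\<in>{0..T}. real k * \<tau> \<le> t \<and> t \<le> real (Suc k) * \<tau> \<longrightarrow>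
        y t i = y (real k * \<tau>) i + integral {real k * \<tau>..t} (\<lambda>s. drift b m K (batch_of (d k) i) i (y s))
          + (w t i - w (real k * \<tau>) i))"

lemma solves_batch_systemD:
  assumes "solves_batch_system T \<tau> N b m K d x0 w y" "i \<in> {1..N}" "t \<in> {0..T}"
    "real k * \<tau> \<le> t" "t \<le> real (Suc k) * \<tau>"
  shows "y t i = y (real k * \<tau>) i
    + integral {real k * \<tau>..t} (\<lambda>s. drift b m K (batch_of (d k) i) i (y s)) + (w t i - w (real k * \<tau>) i)"
  using assms unfolding solves_batch_system_def by blast

context kernels
begin

lemma continuous_on_interaction:
  assumes B: "B \<subseteq> {1..N}" "i \<in> {1..N}"
    and u: "\<And>j. j \<in> {1..N} \<Longrightarrow> continuous_on S (\<lambda>t. u t j)"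
  shows "continuous_on S (\<lambda>t. interaction B i (u t))"
  unfolding interaction_def
proof (intro continuous_intros)
  fix j assume j: "j \<in> B - {i}"
  have "continuous_on UNIV (K i j)"
    using j B K_lipschitz L_nonneg by (intro continuous_on_of_lipschitz[of L]) auto
  moreover have "continuous_on S (\<lambda>t. (u t i, u t j))"
    using j B u by (intro continuous_intros) auto
  ultimately show "continuous_on S (\<lambda>t. K i j (u t i, u t j))"
    using continuous_on_compose2 by blast
qed

end

context euler_scheme
begin

text \<open>The scheme uses exact noise increments, so the noise cancels and only the modulus of
  continuity of the solution enters. The error obeys the recursion
  \<open>e' \<le> e + h * \<Gamma> * (e + \<epsilon>)\<close>, whose solution from 0 is the stated
  bound. The two-sided constant \<open>\<Lambda>\<close> is harmless here because the truncation
  stays fixed.\<close>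

lemma euler_error:
  assumes d: "\<And>k. batches N p (d k)"
    and y: "solves_batch_system T \<tau> N b m K d x0 w y"
    and bound: "\<And>i t. i \<in> {1..N} \<Longrightarrow> t \<in> {0..T} \<Longrightarrow> norm (y t i) \<le> R"
    and f: "\<And>x. norm x \<le> R \<Longrightarrow> f x = b x"
    and g: "\<And>j i. g j i = w (h * real (Suc j)) i - w (h * real j) i"
    and modulus: "\<And>s t i. i \<in> {1..N} \<Longrightarrow> s \<in> {0..T} \<Longrightarrow> t \<in> {0..T} \<Longrightarrow> \<bar>s - t\<bar> \<le> h
        \<Longrightarrow> norm (y s i - y t i) \<le> \<epsilon>"
  defines "\<Gamma> \<equiv> \<Lambda> + 2 * (A * L)"
  shows "h * real j \<le> T \<Longrightarrow> i \<in> {1..N}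
    \<Longrightarrow> norm (euler d x0 g j i - y (h * real j) i) \<le> \<epsilon> * ((1 + h * \<Gamma>) ^ j - 1)"
proof (induction j arbitrary: i)
  case 0
  then show ?case using y by (simp add: solves_batch_system_def)
next
  case (Suc j)
  define k where "k = j div l"
  define s where "s = h * real j"
  define t where "t = h * real (Suc j)"
  define \<delta> where "\<delta> = \<epsilon> * ((1 + h * \<Gamma>) ^ j - 1)"
  define B where "B = batch_of (d k) i"
  define E where "E = euler d x0 g j"
  define F where "F r = f (y r i) + interaction B i (y r)" for r
  note i = \<open>i \<in> {1..N}\<close>
  note B = batch_of_is_batch[OF d i, of k, folded B_def]
  have st: "0 \<le> s" "s \<le> t" "t = s + h" "t \<le> T"
    using Suc.prems h_pos by (auto simp: s_def t_def algebra_simps)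
  have IH: "norm (E i' - y s i') \<le> \<delta>" if "i' \<in> {1..N}" for i'
    using Suc.IH[OF _ that] st by (simp add: s_def \<delta>_def E_def)
  \<comment> \<open>The step stays in one period but may end exactly where the period does, hence
    the closed periods in \<open>solves_batch_system\<close>.\<close>
  have "k * l \<le> j" "Suc j \<le> Suc k * l"
    using l_pos by (auto simp: k_def div_times_less_eq_dividend dividend_less_div_times Suc_le_eq)
  then have "h * real (k * l) \<le> s" "t \<le> h * real (Suc k * l)"
    unfolding s_def t_def using h_pos by (auto intro!: mult_left_mono simp del: of_nat_mult of_nat_Suc mult_Suc)
  then have kt: "real k * \<tau> \<le> s" "t \<le> real (Suc k) * \<tau>" "0 \<le> real k * \<tau>"
    using h_pos unfolding h_l[symmetric] by (simp_all add: algebra_simps)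
  have F_cont: "continuous_on {0..T} F"
    unfolding F_def
  proof (intro continuous_on_add continuous_on_interaction)
    have "continuous_on UNIV f" using Lambda f_lipschitz by (rule continuous_on_of_lipschitz)
    then show "continuous_on {0..T} (\<lambda>r. f (y r i))"
      using y i continuous_on_compose2 unfolding solves_batch_system_def by blast
  qed (use y i B in \<open>auto simp: solves_batch_system_def\<close>)
  \<comment> \<open>Along the solution \<open>b\<close> and \<open>f\<close> coincide, as its path
    stays in the ball of radius \<open>R\<close>.\<close>
  have drift: "integral {real k * \<tau>..r} (\<lambda>s. drift b m K B i (y s)) = integral {real k * \<tau>..r} F"
    if "r \<le> T" for r
    using that kt bound[OF i] f by (intro integral_cong) (auto simp: F_def drift_eq)
  have y_eq: "y r i = y (real k * \<tau>) i + integral {real k * \<tau>..r} F + (w r i - w (real k * \<tau>) i)"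
    if "real k * \<tau> \<le> r" "r \<le> t" for r
  proof -
    have r: "r \<in> {0..T}" "r \<le> real (Suc k) * \<tau>" using that st kt by auto
    show ?thesis
      unfolding solves_batch_systemD[OF y i r(1) that(1) r(2)] using drift[of r] r by (simp add: B_def)
  qed
  have "integral {real k * \<tau>..s} F + integral {s..t} F = integral {real k * \<tau>..t} F"
    using kt st by (intro Henstock_Kurzweil_Integration.integral_combine integrable_continuous_real continuous_on_subset[OF F_cont]) auto
  then have incr: "y t i = y s i + integral {s..t} F + (w t i - w s i)"
    using y_eq[of s] y_eq[of t] kt st by simp
  have step: "euler d x0 g (Suc j) i = E i + h *\<^sub>R drift f m K B i E + (w t i - w s i)"
    by (simp add: g s_def t_def E_def B_def k_def)
  have "integral {s..t} (\<lambda>r. drift f m K B i E - F r) = h *\<^sub>R drift f m K B i E - integral {s..t} F"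
    using st by (subst integral_diff)
      (auto intro!: integrable_continuous_real continuous_on_subset[OF F_cont])
  then have eq: "euler d x0 g (Suc j) i - y t i
      = (E i - y s i) + integral {s..t} (\<lambda>r. drift f m K B i E - F r)"
    unfolding step incr by simp
  have "norm (integral {s..t} (\<lambda>r. drift f m K B i E - F r)) \<le> \<Gamma> * (\<delta> + \<epsilon>) * (t - s)"
  proof (rule integral_bound)
    show "continuous_on {s..t} (\<lambda>r. drift f m K B i E - F r)"
      by (intro continuous_intros continuous_on_subset[OF F_cont]) (use st in auto)
    fix r assume r: "r \<in> {s..t}"
    have close: "norm (E i' - y r i') \<le> \<delta> + \<epsilon>" if "i' \<in> {1..N}" for i'
    proof -
      have "norm (E i' - y r i') \<le> norm (E i' - y s i') + norm (y s i' - y r i')"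
        using norm_triangle_ineq[of "E i' - y s i'" "y s i' - y r i'"] by simp
      then show ?thesis using IH[OF that] modulus[OF that, of s r] r st by auto
    qed
    have "norm (f (E i) - f (y r i)) \<le> \<Lambda> * (\<delta> + \<epsilon>)"
      using f_lipschitz mult_left_mono[OF close[OF i] Lambda] order_trans by blast
    moreover have "norm (interaction B i E - interaction B i (y r)) \<le> 2 * (A * L) * (\<delta> + \<epsilon>)"
      by (rule interaction_lipschitz_sup[OF B close])
    moreover have "drift f m K B i E - F r
        = (f (E i) - f (y r i)) + (interaction B i E - interaction B i (y r))"
      by (simp add: F_def drift_eq)
    ultimately show "norm (drift f m K B i E - F r) \<le> \<Gamma> * (\<delta> + \<epsilon>)"
      using norm_triangle_mono by (metis \<Gamma>_def distrib_right)
  qed (use st in auto)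
  then have "norm (euler d x0 g (Suc j) i - y t i) \<le> \<delta> + \<Gamma> * (\<delta> + \<epsilon>) * h"
    unfolding eq using IH[OF i] st by (intro norm_triangle_mono) auto
  also have "\<dots> = \<epsilon> * ((1 + h * \<Gamma>) ^ Suc j - 1)" by (simp add: \<delta>_def algebra_simps)
  finally show ?case by (simp add: t_def)
qed

end

section \<open>Step size tending to zero for a fixed truncation\<close>

locale truncated_system = kernels N m K A L
  for N m and K :: "nat \<Rightarrow> nat \<Rightarrow> (real ^ 'd) \<times> (real ^ 'd) \<Rightarrow> real ^ 'd" and A L +
  fixes f :: "real ^ 'd \<Rightarrow> real ^ 'd" and \<kappa> \<Lambda> \<tau> :: real
  assumes f_lipschitz: "norm (f x - f y) \<le> \<Lambda> * norm (x - y)"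
    and f_one_sided: "(x - y) \<bullet> (f x - f y) \<le> (\<kappa> - 1) * (norm (x - y))\<^sup>2"
    and kappa: "1 \<le> \<kappa>" and Lambda: "0 \<le> \<Lambda>" and tau: "0 < \<tau>"
begin

definition stepsize :: "nat \<Rightarrow> real" where "stepsize l = \<tau> / real (Suc l)"

definition step_index :: "nat \<Rightarrow> real \<Rightarrow> nat" where "step_index l t = nat \<lfloor>t / stepsize l\<rfloor>"

text \<open>The scheme is taken as the global constant of its locale, which makes sense for every
  \<open>l\<close>; the locale's step-size condition is guaranteed only for large
  \<open>l\<close>.\<close>

definition approx :: "nat \<Rightarrow> (nat \<Rightarrow> nat set set) \<Rightarrow> (nat \<Rightarrow> real ^ 'd) \<Rightarrow> (real \<Rightarrow> nat \<Rightarrow> real ^ 'd)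
    \<Rightarrow> real \<Rightarrow> nat \<Rightarrow> real ^ 'd" where
  "approx l d x0 w t = euler_scheme.euler m K f (stepsize l) (Suc l) d x0
     (\<lambda>j i. w (stepsize l * real (Suc j)) i - w (stepsize l * real j) i) (step_index l t)"

lemma stepsize_pos: "0 < stepsize l" using tau by (simp add: stepsize_def)

lemma stepsize_tendsto: "stepsize \<longlonglongrightarrow> 0"
  using LIMSEQ_Suc[OF lim_const_over_n[of \<tau>]] unfolding stepsize_def .

lemma step_index_bounds:
  assumes "0 \<le> t"
  shows "stepsize l * real (step_index l t) \<le> t" "t - stepsize l * real (step_index l t) \<le> stepsize l"
proof -
  have "0 \<le> t / stepsize l" using assms stepsize_pos[of l] by simp
  then have "real (step_index l t) \<le> t / stepsize l" "t / stepsize l \<le> real (step_index l t) + 1"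
    unfolding step_index_def by linarith+
  then show "stepsize l * real (step_index l t) \<le> t" "t - stepsize l * real (step_index l t) \<le> stepsize l"
    using stepsize_pos[of l] by (simp_all add: field_simps)
qed

lemma eventually_euler_scheme:
  "\<forall>\<^sub>F l in sequentially. euler_scheme N m K A L f \<kappa> \<Lambda> \<tau> (stepsize l) (Suc l)"
proof -
  have "(\<lambda>l. stepsize l * \<Lambda>\<^sup>2) \<longlonglongrightarrow> 0 * \<Lambda>\<^sup>2"
    by (intro tendsto_intros stepsize_tendsto)
  then have "\<forall>\<^sub>F l in sequentially. stepsize l * \<Lambda>\<^sup>2 < 1"
    by (rule order_tendstoD) simp
  then show ?thesis
  proof eventually_elim
    case (elim l)
    show ?case
      by unfold_locales
        (use elim f_lipschitz f_one_sided kappa Lambda stepsize_pos[of l] in \<open>auto simp: stepsize_def\<close>)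
  qed
qed

lemma approx_tendsto:
  assumes d: "\<And>k. batches N p (d k)"
    and y: "solves_batch_system T \<tau> N b m K d x0 w y"
    and bound: "\<And>i t. i \<in> {1..N} \<Longrightarrow> t \<in> {0..T} \<Longrightarrow> norm (y t i) \<le> R"
    and f: "\<And>x. norm x \<le> R \<Longrightarrow> f x = b x"
    and t: "t \<in> {0..T}" and i: "i \<in> {1..N}"
  shows "(\<lambda>l. approx l d x0 w t i) \<longlonglongrightarrow> y t i"
proof (rule tendstoI)
  fix \<epsilon>0 :: real assume "0 < \<epsilon>0"
  define \<Gamma> where "\<Gamma> = \<Lambda> + 2 * (A * L)"
  \<comment> \<open>In the denominator, \<open>exp (\<Gamma> * T)\<close> pays for the accumulated
    Euler error and 1 for rounding \<open>t\<close> down to the grid.\<close>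
  define \<epsilon> where "\<epsilon> = \<epsilon>0 / (exp (\<Gamma> * T) + 1)"
  have G: "0 \<le> \<Gamma>" using Lambda A_nonneg L_nonneg by (simp add: \<Gamma>_def)
  have eps: "0 < \<epsilon>" using \<open>0 < \<epsilon>0\<close> by (simp add: \<epsilon>_def add_pos_pos)
  have "\<forall>\<^sub>F l in sequentially. \<forall>i\<in>{1..N}. \<forall>s\<in>{0..T}. \<forall>t\<in>{0..T}. \<bar>s - t\<bar> \<le> stepsize l
      \<longrightarrow> norm (y s i - y t i) \<le> \<epsilon>"
  proof (rule eventually_ball_finite)
    show "\<forall>i\<in>{1..N}. \<forall>\<^sub>F l in sequentially. \<forall>s\<in>{0..T}. \<forall>t\<in>{0..T}. \<bar>s - t\<bar> \<le> stepsize l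
      \<longrightarrow> norm (y s i - y t i) \<le> \<epsilon>"
    proof
      fix i assume "i \<in> {1..N}"
      then have "uniformly_continuous_on {0..T} (\<lambda>t. y t i)"
        using y by (intro compact_uniformly_continuous) (auto simp: solves_batch_system_def)
      then obtain \<delta> where \<delta>: "\<delta> > 0"
        "\<And>s t. s \<in> {0..T} \<Longrightarrow> t \<in> {0..T} \<Longrightarrow> dist s t < \<delta> \<Longrightarrow> dist (y s i) (y t i) < \<epsilon>"
        using eps unfolding uniformly_continuous_on_def by metis
      have "\<forall>\<^sub>F l in sequentially. stepsize l < \<delta>"
        using stepsize_tendsto \<delta>(1) by (rule order_tendstoD)
      then show "\<forall>\<^sub>F l in sequentially. \<forall>s\<in>{0..T}. \<forall>t\<in>{0..T}. \<bar>s - t\<bar> \<le> stepsize l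
          \<longrightarrow> norm (y s i - y t i) \<le> \<epsilon>"
        by eventually_elim (use \<delta>(2) in \<open>auto simp: dist_norm intro!: less_imp_le\<close>)
    qed
  qed simp
  with eventually_euler_scheme show "\<forall>\<^sub>F l in sequentially. dist (approx l d x0 w t i) (y t i) < \<epsilon>0"
  proof eventually_elim
    case (elim l)
    interpret euler_scheme N m K A L f \<kappa> \<Lambda> \<tau> "stepsize l" "Suc l" by (rule elim)
    let ?j = "step_index l t" and ?h = "stepsize l"
    have j: "?h * real ?j \<le> t" "t - ?h * real ?j \<le> ?h"
      using step_index_bounds[of t l] t by auto
    have j0: "0 \<le> ?h * real ?j" using stepsize_pos[of l] by simp
    have "norm (approx l d x0 w t i - y (?h * real ?j) i) \<le> \<epsilon> * ((1 + ?h * \<Gamma>) ^ ?j - 1)"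
      unfolding approx_def \<Gamma>_def
      by (rule euler_error[OF d y bound f]) (use elim j t i in auto)
    also have "\<dots> < \<epsilon> * exp (\<Gamma> * T)"
    proof -
      have "\<Gamma> * (?h * real ?j) \<le> \<Gamma> * T" using j t G by (intro mult_left_mono) auto
      then have "(1 + ?h * \<Gamma>) ^ ?j \<le> exp (\<Gamma> * T)"
        using power_le_exp[OF G, of ?j] by (meson exp_le_cancel_iff order_trans)
      then show ?thesis using eps by (intro mult_strict_left_mono) auto
    qed
    finally have 1: "norm (approx l d x0 w t i - y (?h * real ?j) i) < \<epsilon> * exp (\<Gamma> * T)" .
    have 2: "norm (y (?h * real ?j) i - y t i) \<le> \<epsilon>" using elim j j0 t i by auto
    have "norm (approx l d x0 w t i - y t i)
        \<le> norm (approx l d x0 w t i - y (?h * real ?j) i) + norm (y (?h * real ?j) i - y t i)"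
      using norm_triangle_ineq[of "approx l d x0 w t i - y (?h * real ?j) i" "y (?h * real ?j) i - y t i"] by simp
    also have "\<dots> < \<epsilon> * (exp (\<Gamma> * T) + 1)" using 1 2 by (simp add: algebra_simps)
    also have "\<dots> = \<epsilon>0" unfolding \<epsilon>_def by (simp add: add_pos_pos less_imp_neq[symmetric])
    finally show ?case by (simp add: dist_norm)
  qed
qed

end

section \<open>Independence of the divisions\<close>

text \<open>
  The source algebras of initial data and noise do not depend on \<open>n\<close>, \<open>p\<close> and the divisions, so dummy
  arguments are supplied for these.
\<close>

definition input_algebra ::
    "'w measure \<Rightarrow> nat \<Rightarrow> (nat \<Rightarrow> 'w \<Rightarrow> real ^ 'd) \<Rightarrow> (nat \<Rightarrow> real \<Rightarrow> 'w \<Rightarrow> real ^ 'd) \<Rightarrow> 'w measure" where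
  "input_algebra P N X0 W = sigma (space P)
     (\<Union>s\<in>Init ` {1..N} \<union> Noise ` {1..N}. source_sigma P 0 0 X0 W (\<lambda>_ _. {}) s)"

text \<open>Independence says that, restricted to the sub-algebra \<open>F\<close>, the measure with
  density \<open>indicator G\<close> is a multiple of the original one. Equality of these two
  measures gives the identity for all integrands at once.\<close>

lemma (in prob_space) nn_integral_indep_event:
  assumes F: "sets F \<subseteq> events" "space F = space M" and G: "G \<in> events"
    and indep: "\<And>A. A \<in> sets F \<Longrightarrow> prob (A \<inter> G) = prob A * prob G"
    and f: "f \<in> borel_measurable F"
  shows "(\<integral>\<^sup>+x. f x * indicator G x \<partial>M) = ennreal (prob G) * (\<integral>\<^sup>+x. f x \<partial>M)"
proof -
  have id: "(\<lambda>x. x) \<in> measurable M F" using F by (intro measurableI) auto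
  have f': "f \<in> borel_measurable M" using measurable_compose[OF id f] .
  have id': "(\<lambda>x. x) \<in> measurable (density M (indicator G)) F"
    using id by simp
  have eq: "distr (density M (indicator G)) F (\<lambda>x. x) = scale_measure (ennreal (prob G)) (distr M F (\<lambda>x. x))"
  proof (rule measure_eqI)
    fix A assume "A \<in> sets (distr (density M (indicator G)) F (\<lambda>x. x))"
    then have A: "A \<in> sets F" by simp
    then have ev: "A \<in> events" using F by auto
    then have "A \<subseteq> space M" by (rule sets.sets_into_space)
    then show "emeasure (distr (density M (indicator G)) F (\<lambda>x. x)) A
        = emeasure (scale_measure (ennreal (prob G)) (distr M F (\<lambda>x. x))) A"
      using G A ev indep[OF A] id id'
      by (simp add: emeasure_distr emeasure_density Int_absorb2 emeasure_eq_measure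
          ennreal_mult[symmetric] mult.commute[of "indicator G _"] indicator_inter_arith[symmetric]
          Int_commute nn_integral_indicator mult_ac)
  qed simp
  have "(\<integral>\<^sup>+x. f x * indicator G x \<partial>M) = (\<integral>\<^sup>+x. f x \<partial>density M (indicator G))"
    using f' G by (subst nn_integral_density) (auto simp: mult.commute)
  also have "\<dots> = (\<integral>\<^sup>+x. f x \<partial>distr (density M (indicator G)) F (\<lambda>x. x))"
    using id' f by (simp add: nn_integral_distr)
  also have "\<dots> = ennreal (prob G) * (\<integral>\<^sup>+x. f x \<partial>M)"
    unfolding eq using id f by (simp add: nn_integral_scale_measure nn_integral_distr)
  finally show ?thesis .
qed

lemma source_sigma_sets: "source_sigma P n p X0 W D s \<subseteq> Pow (space P)"
proof -
  obtain M where "source_sigma P n p X0 W D s = sets M" "space M = space P"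
    by (cases s) (auto intro: that)
  then show ?thesis using sets.space_closed[of M] by simp
qed

lemma source_sigma_Int_stable: "Int_stable (source_sigma P n p X0 W D s)"
  by (cases s) (simp_all add: Int_stable_def sets.Int)

lemma source_sigma_input:
  assumes "s \<in> Init ` {1..N} \<union> Noise ` {1..N}"
  shows "source_sigma P n p X0 W D s = source_sigma P 0 0 X0 W (\<lambda>_ _. {}) s"
  using assms by auto

lemma space_input_algebra: "space (input_algebra P N X0 W) = space P"
  unfolding input_algebra_def by (rule space_measure_of) (use source_sigma_sets in blast)

lemma sets_input_algebra:
  "sets (input_algebra P N X0 W) = sigma_sets (space P)
     (\<Union>s\<in>Init ` {1..N} \<union> Noise ` {1..N}. source_sigma P n p X0 W D s)"
proof -
  have "(\<Union>s\<in>Init ` {1..N} \<union> Noise ` {1..N}. source_sigma P n p X0 W D s)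
      = (\<Union>s\<in>Init ` {1..N} \<union> Noise ` {1..N}. source_sigma P 0 0 X0 W (\<lambda>_ _. {}) s)"
    by (intro SUP_cong refl source_sigma_input)
  moreover have "\<dots> \<subseteq> Pow (space P)" by (intro UN_least source_sigma_sets)
  ultimately show ?thesis unfolding input_algebra_def by (simp only: sets_measure_of)
qed

lemma measurable_input_algebra:
  fixes W :: "nat \<Rightarrow> real \<Rightarrow> 'w \<Rightarrow> real ^ 'd"
  assumes i: "i \<in> {1..N}"
  shows "X0 i \<in> borel_measurable (input_algebra P N X0 W)"
    and "0 \<le> t \<Longrightarrow> W i t \<in> borel_measurable (input_algebra P N X0 W)"
proof -
  have sub: "source_sigma P 0 0 X0 W (\<lambda>_ _. {}) s \<subseteq> sets (input_algebra P N X0 W)"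
    if "s \<in> Init ` {1..N} \<union> Noise ` {1..N}" for s
    using that unfolding sets_input_algebra[where n = 0 and p = 0 and D = "\<lambda>_ _. {}"] by blast
  have 1: "X0 i \<in> borel_measurable (vimage_algebra (space P) (X0 i) borel)"
    by (rule measurable_vimage_algebra1) simp
  then show "X0 i \<in> borel_measurable (input_algebra P N X0 W)"
    using measurable_mono[of borel borel "vimage_algebra (space P) (X0 i) borel" "input_algebra P N X0 W"]
      sub[of "Init i"] i by (auto simp: space_input_algebra)
  let ?V = "vimage_algebra (space P) (\<lambda>\<omega>. \<lambda>t\<in>{0..}. W i t \<omega>) (Pi\<^sub>M {0..} (\<lambda>_. borel))"
  assume t: "0 \<le> t"
  have path: "(\<lambda>\<omega>. \<lambda>t\<in>{0..}. W i t \<omega>) \<in> measurable ?V (Pi\<^sub>M {0..} (\<lambda>_. borel))"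
    by (rule measurable_vimage_algebra1) (auto simp: space_PiM)
  have "(\<lambda>x. x t) \<in> borel_measurable (Pi\<^sub>M {0..} (\<lambda>_. borel :: (real ^ 'd) measure))"
    using t measurable_component_singleton[of t "{0..}" "\<lambda>_. borel"] by simp
  from measurable_compose[OF path this] have "W i t \<in> borel_measurable ?V" using t by simp
  then show "W i t \<in> borel_measurable (input_algebra P N X0 W)"
    using measurable_mono[of borel borel ?V "input_algebra P N X0 W"]
      sub[of "Noise i"] i by (auto simp: space_input_algebra)
qed

lemma random_inputs_divisions:
  assumes R: "random_inputs P n p X0 W D"
  shows "\<omega> \<in> space P \<Longrightarrow> D k \<omega> \<in> batch_divisions n p"
    and "d \<in> batch_divisions n p \<Longrightarrow> D k -` {d} \<inter> space P \<in> sets P"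
    and "d \<in> batch_divisions n p
      \<Longrightarrow> measure P (D k -` {d} \<inter> space P) = 1 / real (card (batch_divisions n p))"
proof -
  have D: "D k \<in> measurable P (count_space (batch_divisions n p))"
    "distr P (count_space (batch_divisions n p)) (D k) = uniform_count_measure (batch_divisions n p)"
    using R by (auto simp: random_inputs_def)
  show "\<omega> \<in> space P \<Longrightarrow> D k \<omega> \<in> batch_divisions n p"
    using measurable_space[OF D(1)] by simp
  assume d: "d \<in> batch_divisions n p"
  then show "D k -` {d} \<inter> space P \<in> sets P" using measurable_sets[OF D(1)] by simp
  have "measure P (D k -` {d} \<inter> space P) = measure (distr P (count_space (batch_divisions n p)) (D k)) {d}"
    using d by (subst measure_distr[OF D(1)]) auto
  also have "\<dots> = 1 / real (card (batch_divisions n p))"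
    unfolding D(2) using d finite_batch_divisions by (subst measure_uniform_count_measure) auto
  finally show "measure P (D k -` {d} \<inter> space P) = 1 / real (card (batch_divisions n p))" .
qed

text \<open>The sources are grouped into blocks indexed by \<open>nat option\<close>:
  \<open>None\<close> collects all initial data and noise, \<open>Some k\<close> holds the division
  \<open>k\<close>. Intersection-stable generators make the algebras generated by the blocks
  independent, and prescribing \<open>Q\<close> divisions is a finite intersection of events from
  distinct blocks.\<close>

lemma random_inputs_indep:
  assumes R: "random_inputs P n p X0 W D" and A: "A \<in> sets (input_algebra P (n * p) X0 W)"
    and d: "\<And>k. k < Q \<Longrightarrow> d k \<in> batch_divisions n p"
  defines "G \<equiv> space P \<inter> (\<Inter>k<Q. D k -` {d k})"
  shows "A \<in> sets P" "G \<in> sets P"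
    "measure P G = (1 / real (card (batch_divisions n p))) ^ Q"
    "measure P (A \<inter> G) = measure P A * measure P G"
proof -
  let ?c = "1 / real (card (batch_divisions n p))"
  interpret prob_space P using R by (simp add: random_inputs_def)
  define I where "I j = (case j of None \<Rightarrow> Init ` {1..n * p} \<union> Noise ` {1..n * p} | Some k \<Rightarrow> {Batch k})"
    for j :: "nat option"
  define \<S> where "\<S> j = sigma_sets (space P) (\<Union>s\<in>I j. source_sigma P n p X0 W D s)" for j
  have "(\<Union>j. I j) = Init ` {1..n * p} \<union> Noise ` {1..n * p} \<union> range Batch"
    by (auto simp: I_def UNIV_option_conv)
  then have indep: "indep_sets (source_sigma P n p X0 W D) (\<Union>j. I j)"
    using R by (simp add: random_inputs_def)
  have ind: "indep_sets \<S> UNIV"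
    unfolding \<S>_def
    by (intro indep_sets_collect_sigma indep source_sigma_Int_stable)
      (auto simp: I_def disjoint_family_on_def split: option.splits)
  have None: "\<S> None = sets (input_algebra P (n * p) X0 W)"
    unfolding \<S>_def I_def by (simp add: sets_input_algebra[where n = n and p = p and D = D])
  have Some: "D k -` {d k} \<inter> space P \<in> \<S> (Some k)" if "k < Q" for k
    using d[OF that] unfolding \<S>_def I_def
    by (auto intro!: sigma_sets.Basic in_vimage_algebra)
  have main: "A' \<in> events \<and> prob (A' \<inter> G) = prob A' * ?c ^ Q" if A': "A' \<in> \<S> None" for A'
  proof
    show "A' \<in> events" using ind A' by (auto simp: indep_sets_def)
    then have sub: "A' \<subseteq> space P" by (rule sets.sets_into_space)
    define E where "E j = (case j of None \<Rightarrow> A' | Some k \<Rightarrow> D k -` {d k} \<inter> space P)" for j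
    let ?J = "insert None (Some ` {..<Q})"
    have "prob (\<Inter>j\<in>?J. E j) = (\<Prod>j\<in>?J. prob (E j))"
      by (rule indep_setsD[OF ind]) (use A' Some in \<open>auto simp: E_def\<close>)
    also have "(\<Inter>j\<in>?J. E j) = A' \<inter> G" using sub by (auto simp: E_def G_def)
    also have "(\<Prod>j\<in>?J. prob (E j)) = prob A' * (\<Prod>k<Q. prob (D k -` {d k} \<inter> space P))"
      by (subst prod.insert) (auto simp: prod.reindex E_def)
    also have "(\<Prod>k<Q. prob (D k -` {d k} \<inter> space P)) = (\<Prod>k<Q. ?c)"
      by (intro prod.cong refl random_inputs_divisions(3)[OF R] d) auto
    finally show "prob (A' \<inter> G) = prob A' * ?c ^ Q" by simp
  qed
  have "space P \<in> \<S> None" unfolding \<S>_def by (rule sigma_sets_top)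
  from main[OF this] show 1: "prob G = ?c ^ Q"
    by (simp add: G_def prob_space flip: Int_assoc)
  show "A \<in> events" "prob (A \<inter> G) = prob A * prob G" using main[of A] A 1 by (auto simp: None)
  show "G \<in> events"
  \<comment> \<open>An empty intersection is not covered by \<open>sets.finite_INT\<close>; in that
    case \<open>G\<close> is the whole space.\<close>
  proof (cases "Q = 0")
    case False
    then have "G = (\<Inter>k\<in>{..<Q}. D k -` {d k} \<inter> space P)" by (auto simp: G_def)
    also have "\<dots> \<in> events"
      using False d by (intro sets.finite_INT random_inputs_divisions(2)[OF R]) auto
    finally show ?thesis .
  qed (simp add: G_def)
qed

text \<open>The events \<open>G d\<close>, for \<open>d\<close> in \<open>S\<close>, partition the
  space; each has probability \<open>1 / card S\<close> and is independent of \<open>F d\<close>.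
  Restricting the drawn sequence to \<open>{..<Q}\<close> makes it an element of the finite set
  \<open>S\<close>.\<close>

lemma nn_integral_over_divisions:
  fixes Q :: nat and X0 :: "nat \<Rightarrow> 'w \<Rightarrow> real ^ 'd"
  assumes R: "random_inputs P n p X0 W D"
  defines "S \<equiv> {..<Q} \<rightarrow>\<^sub>E batch_divisions n p"
  assumes F: "\<And>d. d \<in> S \<Longrightarrow> F d \<in> borel_measurable (input_algebra P (n * p) X0 W)"
  shows "(\<lambda>\<omega>. F (\<lambda>k\<in>{..<Q}. D k \<omega>) \<omega>) \<in> borel_measurable P"
    "(\<integral>\<^sup>+\<omega>. F (\<lambda>k\<in>{..<Q}. D k \<omega>) \<omega> \<partial>P)
       = (\<integral>\<^sup>+\<omega>. ennreal (1 / real (card S)) * (\<Sum>d\<in>S. F d \<omega>) \<partial>P)"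
proof -
  interpret prob_space P using R by (simp add: random_inputs_def)
  define G where "G d = space P \<inter> (\<Inter>k<Q. D k -` {d k})" for d :: "nat \<Rightarrow> nat set set"
  have S: "finite S" unfolding S_def by (intro finite_PiE finite_batch_divisions) auto
  have dS: "d k \<in> batch_divisions n p" if "d \<in> S" "k < Q" for d k using that by (auto simp: S_def)
  have sub: "sets (input_algebra P (n * p) X0 W) \<subseteq> events"
    using random_inputs_indep(1)[OF R, of _ 0] by blast
  have FP: "F d \<in> borel_measurable P" if "d \<in> S" for d
    using F[OF that] measurable_mono[of borel borel "input_algebra P (n * p) X0 W" P] sub
    by (auto simp: space_input_algebra)
  have top: "space P \<in> sets (input_algebra P (n * p) X0 W)"
    using sets.top[of "input_algebra P (n * p) X0 W"] by (simp add: space_input_algebra)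
  have ind: "G d \<in> events" "prob (G d) = 1 / real (card S)" if d: "d \<in> S" for d
  proof -
    show "G d \<in> events" unfolding G_def by (rule random_inputs_indep(2)[OF R top dS[OF d]])
    have "prob (G d) = (1 / real (card (batch_divisions n p))) ^ Q"
      unfolding G_def by (rule random_inputs_indep(3)[OF R top dS[OF d]])
    then show "prob (G d) = 1 / real (card S)" by (simp add: S_def card_PiE power_one_over)
  qed
  have indep: "prob (A \<inter> G d) = prob A * prob (G d)"
    if "d \<in> S" "A \<in> sets (input_algebra P (n * p) X0 W)" for d A
    unfolding G_def by (rule random_inputs_indep(4)[OF R that(2) dS[OF that(1)]])
  have eq: "F (\<lambda>k\<in>{..<Q}. D k \<omega>) \<omega> = (\<Sum>d\<in>S. F d \<omega> * indicator (G d) \<omega>)" if \<omega>: "\<omega> \<in> space P" for \<omega>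
  proof -
    let ?d = "\<lambda>k\<in>{..<Q}. D k \<omega>"
    have d: "?d \<in> S" using random_inputs_divisions(1)[OF R \<omega>] by (auto simp: S_def)
    have "\<omega> \<in> G e \<longleftrightarrow> e = ?d" if e: "e \<in> S" for e
    proof
      assume "\<omega> \<in> G e"
      then show "e = ?d"
        by (intro PiE_ext[OF e[unfolded S_def] d[unfolded S_def]]) (auto simp: G_def)
    next
      assume "e = ?d"
      then show "\<omega> \<in> G e" using \<omega> by (simp add: G_def)
    qed
    then have "(\<Sum>d\<in>S. F d \<omega> * indicator (G d) \<omega>) = (\<Sum>d\<in>S. if d = ?d then F d \<omega> else 0)"
      by (intro sum.cong) (auto simp: indicator_def)
    then show ?thesis using d S by simp
  qed
  have "(\<lambda>\<omega>. \<Sum>d\<in>S. F d \<omega> * indicator (G d) \<omega>) \<in> borel_measurable P"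
    using FP ind(1) by (intro borel_measurable_sum borel_measurable_times_ennreal borel_measurable_indicator) auto
  then show "(\<lambda>\<omega>. F (\<lambda>k\<in>{..<Q}. D k \<omega>) \<omega>) \<in> borel_measurable P"
    by (subst measurable_cong[where g = "\<lambda>\<omega>. \<Sum>d\<in>S. F d \<omega> * indicator (G d) \<omega>"]) (simp_all add: eq)
  have "(\<integral>\<^sup>+\<omega>. F (\<lambda>k\<in>{..<Q}. D k \<omega>) \<omega> \<partial>P) = (\<integral>\<^sup>+\<omega>. (\<Sum>d\<in>S. F d \<omega> * indicator (G d) \<omega>) \<partial>P)"
    by (rule nn_integral_cong) (rule eq)
  also have "\<dots> = (\<Sum>d\<in>S. \<integral>\<^sup>+\<omega>. F d \<omega> * indicator (G d) \<omega> \<partial>P)"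
    using FP ind(1) by (subst nn_integral_sum) auto
  also have "\<dots> = (\<Sum>d\<in>S. ennreal (1 / real (card S)) * (\<integral>\<^sup>+\<omega>. F d \<omega> \<partial>P))"
  proof (intro sum.cong refl)
    fix d assume d: "d \<in> S"
    have "(\<integral>\<^sup>+\<omega>. F d \<omega> * indicator (G d) \<omega> \<partial>P) = ennreal (prob (G d)) * (\<integral>\<^sup>+\<omega>. F d \<omega> \<partial>P)"
    proof (rule nn_integral_indep_event)
      show "sets (input_algebra P (n * p) X0 W) \<subseteq> events" by (rule sub)
    qed (use d ind F indep in \<open>auto simp: space_input_algebra\<close>)
    then show "(\<integral>\<^sup>+\<omega>. F d \<omega> * indicator (G d) \<omega> \<partial>P) = ennreal (1 / real (card S)) * (\<integral>\<^sup>+\<omega>. F d \<omega> \<partial>P)"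
      by (simp only: ind(2)[OF d])
  qed
  also have "\<dots> = ennreal (1 / real (card S)) * (\<integral>\<^sup>+\<omega>. (\<Sum>d\<in>S. F d \<omega>) \<partial>P)"
    using FP by (subst nn_integral_sum) (auto simp: sum_distrib_left)
  also have "\<dots> = (\<integral>\<^sup>+\<omega>. ennreal (1 / real (card S)) * (\<Sum>d\<in>S. F d \<omega>) \<partial>P)"
    using FP by (subst nn_integral_cmult) auto
  finally show "(\<integral>\<^sup>+\<omega>. F (\<lambda>k\<in>{..<Q}. D k \<omega>) \<omega> \<partial>P)
       = (\<integral>\<^sup>+\<omega>. ennreal (1 / real (card S)) * (\<Sum>d\<in>S. F d \<omega>) \<partial>P)" .
qed

section \<open>Passage to the limit\<close>

context kernels
begin

lemma continuous_on_drift: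
  assumes b: "continuous_on UNIV b" and B: "B \<subseteq> {1..N}" and i: "i \<in> {1..N}"
    and u: "\<And>j. j \<in> {1..N} \<Longrightarrow> continuous_on S (\<lambda>t. u t j)"
  shows "continuous_on S (\<lambda>t. drift b m K B i (u t))"
  unfolding drift_eq
  by (intro continuous_on_add continuous_on_interaction continuous_on_compose2[OF b] B i u) auto

text \<open>The periods are artificial for the full system: its integral equation is restarted at
  each \<open>real k * \<tau>\<close> by subtracting two instances of it.\<close>

lemma full_system_solves:
  assumes b: "continuous_on UNIV b" and "0 < \<tau>" "0 \<le> T"
    and x: "\<And>i. i \<in> {1..N} \<Longrightarrow> continuous_on {0..T} (x i)"
    and eq: "\<And>i t. i \<in> {1..N} \<Longrightarrow> t \<in> {0..T} \<Longrightarrow>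
      x i t = x0 i + integral {0..t} (\<lambda>s. drift b m K {1..N} i (\<lambda>j. x j s)) + w t i"
    and w: "\<And>i. i \<in> {1..N} \<Longrightarrow> w 0 i = 0"
  shows "solves_batch_system T \<tau> N b m K (\<lambda>_. {{1..N}}) x0 w (\<lambda>t i. x i t)"
  unfolding solves_batch_system_def
proof (intro conjI ballI allI impI)
  fix i assume i: "i \<in> {1..N}"
  show "continuous_on {0..T} (x i)" by (rule x[OF i])
  show "x i 0 = x0 i" using eq[OF i, of 0] w[OF i] \<open>0 \<le> T\<close> by simp
  fix k t assume t: "t \<in> {0..T}" and kt: "real k * \<tau> \<le> t \<and> t \<le> real (Suc k) * \<tau>"
  have full: "batch_of {{1..N}} i = {1..N}"
    by (rule batch_of_eq[of "{1..N}"]) (use i in \<open>auto simp: partition_on_def\<close>)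
  have k: "real k * \<tau> \<in> {0..T}" using t kt \<open>0 < \<tau>\<close> by auto
  let ?F = "\<lambda>s. drift b m K {1..N} i (\<lambda>j. x j s)"
  have "continuous_on {0..t} ?F"
    using t by (intro continuous_on_drift b i continuous_on_subset[OF x]) auto
  then have "integral {0..real k * \<tau>} ?F + integral {real k * \<tau>..t} ?F = integral {0..t} ?F"
    using kt k by (intro Henstock_Kurzweil_Integration.integral_combine integrable_continuous_real) auto
  then show "x i t = x i (real k * \<tau>)
      + integral {real k * \<tau>..t} (\<lambda>s. drift b m K (batch_of {{1..N}} i) i (\<lambda>i. x i s))
      + (w t i - w (real k * \<tau>) i)"
    unfolding full eq[OF i t] eq[OF i k] by simp
qed

text \<open>The given equation holds on half-open periods. Its residual is continuous and vanishes
  on \<open>{?a..<t}\<close>, hence also at \<open>t\<close>, which may be the right end of the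
  period, where the next division takes over.\<close>

lemma batch_system_solves:
  assumes b: "continuous_on UNIV b" and "0 < \<tau>" and d: "\<And>k. batches N p (d k)"
    and x: "\<And>i. i \<in> {1..N} \<Longrightarrow> continuous_on {0..T} (x i)"
    and x0: "\<And>i. i \<in> {1..N} \<Longrightarrow> x i 0 = x0 i"
    and w: "\<And>i. i \<in> {1..N} \<Longrightarrow> continuous_on {0..} (\<lambda>t. w t i)"
    and eq: "\<And>k B i t. B \<in> d k \<Longrightarrow> i \<in> B \<Longrightarrow> t \<in> {0..T} \<Longrightarrow> real k * \<tau> \<le> t \<Longrightarrow> t < real (Suc k) * \<tau>
      \<Longrightarrow> x i t = x i (real k * \<tau>) + integral {real k * \<tau>..t} (\<lambda>s. drift b m K B i (\<lambda>j. x j s))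
            + (w t i - w (real k * \<tau>) i)"
  shows "solves_batch_system T \<tau> N b m K d x0 w (\<lambda>t i. x i t)"
  unfolding solves_batch_system_def
proof (intro conjI ballI allI impI)
  fix i assume i: "i \<in> {1..N}"
  show "continuous_on {0..T} (x i)" by (rule x[OF i])
  show "x i 0 = x0 i" by (rule x0[OF i])
  fix k t assume t: "t \<in> {0..T}" and kt: "real k * \<tau> \<le> t \<and> t \<le> real (Suc k) * \<tau>"
  define B where "B = batch_of (d k) i"
  have B: "B \<in> d k" "i \<in> B" "B \<subseteq> {1..N}"
    using batch_of_mem[of "{1..N}" "d k" i] batch_of_subset(1)[OF d i, of k] d[of k] i
    by (auto simp: B_def batches_def)
  let ?F = "\<lambda>s. drift b m K B i (\<lambda>j. x j s)"
  let ?a = "real k * \<tau>"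
  let ?r = "\<lambda>t. x i t - (x i ?a + integral {?a..t} ?F + (w t i - w ?a i))"
  have a: "0 \<le> ?a" using \<open>0 < \<tau>\<close> by simp
  show "x i t = x i ?a + integral {?a..t} (\<lambda>s. drift b m K (batch_of (d k) i) i (\<lambda>i. x i s)) + (w t i - w ?a i)"
  proof (cases "?a < t")
    case True
    have sub: "{?a..t} \<subseteq> {0..T}" using a t by auto
    have "continuous_on {?a..t} ?F"
      by (intro continuous_on_drift b i B continuous_on_subset[OF x sub])
    then have "continuous_on {?a..t} (\<lambda>t. integral {?a..t} ?F)"
      by (intro indefinite_integral_continuous_1 integrable_continuous_real)
    moreover have "continuous_on {?a..t} (\<lambda>t. w t i)"
      by (rule continuous_on_subset[OF w[OF i]]) (use a in auto)
    ultimately have "continuous_on {?a..t} ?r"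
      by (intro continuous_intros continuous_on_subset[OF x[OF i] sub]) auto
    then have "closed {s \<in> {?a..t}. ?r s = 0}"
      by (intro continuous_closed_preimage_constant) auto
    moreover have "{?a..<t} \<subseteq> {s \<in> {?a..t}. ?r s = 0}"
    proof
      fix s assume s: "s \<in> {?a..<t}"
      then have "s \<in> {0..T}" "s < real (Suc k) * \<tau>" using sub kt by auto
      then show "s \<in> {s \<in> {?a..t}. ?r s = 0}"
        using eq[OF B(1,2), of s] s by simp
    qed
    ultimately have "closure {?a..<t} \<subseteq> {s \<in> {?a..t}. ?r s = 0}" by (rule closure_minimal[rotated])
    moreover have "t \<in> closure {?a..<t}" using True by simp
    ultimately have "?r t = 0" by blast
    then show ?thesis by (simp add: B_def)
  qed (use kt in auto)
qed

end

context truncated_system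
begin

text \<open>For every single outcome the average over divisions obeys the same deterministic bound,
  so integrating it requires no moments of the initial data.\<close>

lemma approx_mean_square_error:
  fixes X0 :: "nat \<Rightarrow> 'w \<Rightarrow> real ^ 'd" and \<sigma> :: real
  assumes R: "random_inputs P n p X0 W D" and N: "N = n * p" "2 \<le> p" "2 \<le> N"
    and t: "t \<in> {0..T}" and l: "euler_scheme N m K A L f \<kappa> \<Lambda> \<tau> (stepsize l) (Suc l)"
  defines "w \<equiv> \<lambda>\<omega> s i. \<sigma> *\<^sub>R W i s \<omega>"
  defines "G \<equiv> \<lambda>\<omega>. ennreal (\<Sum>i=1..N. (norm (approx l (\<lambda>k. D k \<omega>) (\<lambda>i. X0 i \<omega>) (w \<omega>) t i
      - approx l (\<lambda>_. {{1..N}}) (\<lambda>i. X0 i \<omega>) (w \<omega>) t i))\<^sup>2)"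
    and "c \<equiv> T * exp ((2 * \<kappa> + 1 + 4 * (A * L)) * T) * (8 * (A * L)\<^sup>2 * (exp (\<kappa> * T) + 1))"
  shows "G \<in> borel_measurable P" "(\<integral>\<^sup>+\<omega>. G \<omega> \<partial>P) \<le> ennreal (c * \<tau> * real N)"
proof -
  interpret prob_space P using R by (simp add: random_inputs_def)
  interpret E: euler_scheme N m K A L f \<kappa> \<Lambda> \<tau> "stepsize l" "Suc l" by (rule l)
  define j where "j = step_index l t"
  \<comment> \<open>Enough periods to cover \<open>[0, T]\<close>, so the state at step
    \<open>j\<close> depends on the first \<open>Q\<close> divisions only.\<close>
  define Q where "Q = nat \<lceil>T / \<tau>\<rceil>"
  define S where "S = {..<Q} \<rightarrow>\<^sub>E batch_divisions n p"
  define g where "g \<omega> j i = w \<omega> (stepsize l * real (Suc j)) i - w \<omega> (stepsize l * real j) i" for \<omega> j i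
  define x0 where "x0 \<omega> i = X0 i \<omega>" for \<omega> i
  define e where "e d \<omega> = (\<Sum>i=1..N. (norm (E.euler d (x0 \<omega>) (g \<omega>) j i
      - E.euler (\<lambda>_. {{1..N}}) (x0 \<omega>) (g \<omega>) j i))\<^sup>2)" for d \<omega>
  have jT: "stepsize l * real j \<le> T" using step_index_bounds(1)[of t l] t by (simp add: j_def)
  then have "real j \<le> T / \<tau> * real (Suc l)" using tau by (simp add: stepsize_def field_simps)
  also have "\<dots> \<le> real Q * real (Suc l)"
    unfolding Q_def by (intro mult_right_mono) linarith+
  finally have jQ: "j \<le> Q * Suc l" by (simp only: of_nat_mult[symmetric] of_nat_le_iff)
  have G: "G \<omega> = ennreal (e (\<lambda>k\<in>{..<Q}. D k \<omega>) \<omega>)" for \<omega>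
    unfolding G_def e_def approx_def j_def[symmetric] x0_def g_def
    by (subst E.euler_cong[of Q "\<lambda>k. D k \<omega>" "\<lambda>k\<in>{..<Q}. D k \<omega>", OF _ jQ]) auto
  let ?M = "input_algebra P (n * p) X0 W"
  have x0_meas: "(\<lambda>\<omega>. x0 \<omega> i) \<in> borel_measurable ?M" if "i \<in> {1..N}" for i
    using measurable_input_algebra(1)[of i "n * p" X0 P W] that N by (simp add: x0_def)
  have g_meas: "(\<lambda>\<omega>. g \<omega> j i) \<in> borel_measurable ?M" if "i \<in> {1..N}" for i j
    unfolding g_def w_def
    by (intro borel_measurable_diff borel_measurable_scaleR borel_measurable_const
        measurable_input_algebra(2)) (use that N stepsize_pos[of l] in auto)
  have S: "batches N p (d k)" if "d \<in> S" "k < Q" for d k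
    using that batch_divisions_batches[of "d k" n p] N by (auto simp: S_def)
  have F: "(\<lambda>\<omega>. ennreal (e d \<omega>)) \<in> borel_measurable ?M" if d: "d \<in> S" for d
  proof -
    have "(\<lambda>\<omega>. E.euler d (x0 \<omega>) (g \<omega>) j i) \<in> borel_measurable ?M" if "i \<in> {1..N}" for i
      by (rule E.measurable_euler[OF S[OF d] x0_meas g_meas jQ that])
    moreover have "(\<lambda>\<omega>. E.euler (\<lambda>_. {{1..N}}) (x0 \<omega>) (g \<omega>) j i) \<in> borel_measurable ?M"
      if "i \<in> {1..N}" for i
      by (rule E.measurable_euler[OF batches_single[OF \<open>2 \<le> N\<close>] x0_meas g_meas jQ that])
    ultimately show ?thesis unfolding e_def
      by (intro measurable_compose[OF _ measurable_ennreal] borel_measurable_sum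
          borel_measurable_power borel_measurable_norm borel_measurable_diff) auto
  qed
  note avg = nn_integral_over_divisions[OF R, of Q "\<lambda>d \<omega>. ennreal (e d \<omega>)", folded S_def, OF F]
  show "G \<in> borel_measurable P" unfolding G using avg(1) .
  have e_bound: "ennreal (1 / real (card S)) * (\<Sum>d\<in>S. ennreal (e d \<omega>)) \<le> ennreal (c * \<tau> * real N)" for \<omega>
  proof -
    have c: "0 \<le> c * \<tau> * real N" using t tau by (simp add: c_def)
    have "(\<Sum>d\<in>S. e d \<omega>) \<le> c * \<tau> * (real (card S) * real N)"
      unfolding e_def c_def S_def by (rule E.mean_square_error[OF N jT jQ])
    then have "1 / real (card S) * (\<Sum>d\<in>S. e d \<omega>) \<le> 1 / real (card S) * (c * \<tau> * (real (card S) * real N))"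
      by (intro mult_left_mono) auto
    \<comment> \<open>Were \<open>S\<close> empty, \<open>1 / real (card S)\<close> would be 0 and
      the left side would vanish.\<close>
    also have "\<dots> \<le> c * \<tau> * real N" using c by (cases "card S = 0") auto
    finally have *: "1 / real (card S) * (\<Sum>d\<in>S. e d \<omega>) \<le> c * \<tau> * real N" .
    have e0: "0 \<le> e d \<omega>" for d by (simp add: e_def sum_nonneg)
    have "ennreal (1 / real (card S)) * (\<Sum>d\<in>S. ennreal (e d \<omega>)) = ennreal (1 / real (card S) * (\<Sum>d\<in>S. e d \<omega>))"
      unfolding sum_ennreal[OF e0] by (rule ennreal_mult'[symmetric]) simp
    then show ?thesis using * by (simp add: ennreal_leI)
  qed
  have "(\<integral>\<^sup>+\<omega>. G \<omega> \<partial>P) = (\<integral>\<^sup>+\<omega>. ennreal (1 / real (card S)) * (\<Sum>d\<in>S. ennreal (e d \<omega>)) \<partial>P)"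
    unfolding G by (rule avg(2))
  also have "\<dots> \<le> (\<integral>\<^sup>+\<omega>. ennreal (c * \<tau> * real N) \<partial>P)"
    by (intro nn_integral_mono e_bound)
  finally show "(\<integral>\<^sup>+\<omega>. G \<omega> \<partial>P) \<le> ennreal (c * \<tau> * real N)" by (simp add: emeasure_space_1)
qed

text \<open>\<open>\<Phi>\<close> is built from the inputs alone, as a lower limit of scheme errors,
  and is chosen before the solutions \<open>y\<close> and \<open>z\<close>. It is therefore
  measurable and bounded in mean although nothing is known about how the solutions depend on the
  inputs; it equals their squared distance whenever both paths stay in the ball.\<close>

lemma limit_mean_square_error:
  fixes X0 :: "nat \<Rightarrow> 'w \<Rightarrow> real ^ 'd" and \<sigma> :: real
  assumes R: "random_inputs P n p X0 W D" and N: "N = n * p" "2 \<le> p" "2 \<le> N"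
    and t: "t \<in> {0..T}" and f: "\<And>x. norm x \<le> r \<Longrightarrow> f x = b x"
  defines "w \<equiv> \<lambda>\<omega> s i. \<sigma> *\<^sub>R W i s \<omega>"
    and "c \<equiv> T * exp ((2 * \<kappa> + 1 + 4 * (A * L)) * T) * (8 * (A * L)\<^sup>2 * (exp (\<kappa> * T) + 1))"
  shows "\<exists>\<Phi>\<in>borel_measurable P. (\<integral>\<^sup>+\<omega>. \<Phi> \<omega> \<partial>P) \<le> ennreal (c * \<tau> * real N) \<and>
    (\<forall>\<omega>\<in>space P. \<forall>y z.
      solves_batch_system T \<tau> N b m K (\<lambda>k. D k \<omega>) (\<lambda>i. X0 i \<omega>) (w \<omega>) y \<longrightarrow>
      solves_batch_system T \<tau> N b m K (\<lambda>_. {{1..N}}) (\<lambda>i. X0 i \<omega>) (w \<omega>) z \<longrightarrow>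
      (\<forall>i\<in>{1..N}. \<forall>s\<in>{0..T}. norm (y s i) \<le> r \<and> norm (z s i) \<le> r) \<longrightarrow>
      \<Phi> \<omega> = ennreal (\<Sum>i=1..N. (norm (y t i - z t i))\<^sup>2))"
proof -
  obtain l0 where l0: "\<And>l. l0 \<le> l \<Longrightarrow> euler_scheme N m K A L f \<kappa> \<Lambda> \<tau> (stepsize l) (Suc l)"
    using eventually_euler_scheme unfolding eventually_sequentially by blast
  define G where "G l \<omega> = ennreal (\<Sum>i=1..N. (norm (approx l (\<lambda>k. D k \<omega>) (\<lambda>i. X0 i \<omega>) (w \<omega>) t i
      - approx l (\<lambda>_. {{1..N}}) (\<lambda>i. X0 i \<omega>) (w \<omega>) t i))\<^sup>2)" for l \<omega>
  \<comment> \<open>The shift by \<open>l0\<close> skips the schemes whose step size is possibly too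
    large for the estimate.\<close>
  have G: "G (l + l0) \<in> borel_measurable P" "(\<integral>\<^sup>+\<omega>. G (l + l0) \<omega> \<partial>P) \<le> ennreal (c * \<tau> * real N)" for l
    using approx_mean_square_error[OF R N t l0[of "l + l0"], of \<sigma>] unfolding G_def w_def c_def by simp_all
  define \<Phi> where "\<Phi> \<omega> = liminf (\<lambda>l. G (l + l0) \<omega>)" for \<omega>
  show ?thesis
  proof (intro bexI[of _ \<Phi>] conjI ballI allI impI)
    show "\<Phi> \<in> borel_measurable P" unfolding \<Phi>_def using G(1) by (rule borel_measurable_liminf)
    have "(\<integral>\<^sup>+\<omega>. \<Phi> \<omega> \<partial>P) \<le> liminf (\<lambda>l. \<integral>\<^sup>+\<omega>. G (l + l0) \<omega> \<partial>P)"
      unfolding \<Phi>_def using G(1) by (rule nn_integral_liminf)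
    also have "\<dots> \<le> liminf (\<lambda>l :: nat. ennreal (c * \<tau> * real N))"
      by (intro Liminf_mono always_eventually allI G(2))
    finally show "(\<integral>\<^sup>+\<omega>. \<Phi> \<omega> \<partial>P) \<le> ennreal (c * \<tau> * real N)" by (simp add: Liminf_const)
    fix \<omega> y z
    assume \<omega>: "\<omega> \<in> space P"
      and y: "solves_batch_system T \<tau> N b m K (\<lambda>k. D k \<omega>) (\<lambda>i. X0 i \<omega>) (w \<omega>) y"
      and z: "solves_batch_system T \<tau> N b m K (\<lambda>_. {{1..N}}) (\<lambda>i. X0 i \<omega>) (w \<omega>) z"
      and r: "\<forall>i\<in>{1..N}. \<forall>s\<in>{0..T}. norm (y s i) \<le> r \<and> norm (z s i) \<le> r"
    have d: "batches N p (D k \<omega>)" for k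
      using batch_divisions_batches[OF random_inputs_divisions(1)[OF R \<omega>]] N by simp
    have "(\<lambda>l. approx l (\<lambda>k. D k \<omega>) (\<lambda>i. X0 i \<omega>) (w \<omega>) t i) \<longlonglongrightarrow> y t i" if "i \<in> {1..N}" for i
      by (rule approx_tendsto[OF d y _ f t that]) (use r in auto)
    moreover have "(\<lambda>l. approx l (\<lambda>_. {{1..N}}) (\<lambda>i. X0 i \<omega>) (w \<omega>) t i) \<longlonglongrightarrow> z t i"
      if "i \<in> {1..N}" for i
      by (rule approx_tendsto[OF batches_single[OF \<open>2 \<le> N\<close>] z _ f t that]) (use r in auto)
    ultimately have "(\<lambda>l. G l \<omega>) \<longlonglongrightarrow> ennreal (\<Sum>i=1..N. (norm (y t i - z t i))\<^sup>2)"
      unfolding G_def by (intro tendsto_ennrealI tendsto_intros) auto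
    then have "(\<lambda>l. G (l + l0) \<omega>) \<longlonglongrightarrow> ennreal (\<Sum>i=1..N. (norm (y t i - z t i))\<^sup>2)"
      by (rule LIMSEQ_ignore_initial_segment)
    then show "\<Phi> \<omega> = ennreal (\<Sum>i=1..N. (norm (y t i - z t i))\<^sup>2)"
      unfolding \<Phi>_def by (intro lim_imp_Liminf) auto
  qed
qed

end

section \<open>Transfer of the bound to the given solutions\<close>

lemma AE_solves_batch_system:
  assumes R: "random_inputs P n p X0 W D" and N: "N = n * p" "2 \<le> p" "2 \<le> N"
    and "kernels N m K A L" "continuous_on UNIV b" "0 < \<tau>" "0 \<le> T"
    and X: "full_system_solution P T N \<sigma> b m K X0 W X"
    and Xt: "random_batch_solution P T N \<sigma> b m K X0 W \<tau> D Xt"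
  shows "AE \<omega> in P.
      solves_batch_system T \<tau> N b m K (\<lambda>k. D k \<omega>) (\<lambda>i. X0 i \<omega>) (\<lambda>s i. \<sigma> *\<^sub>R W i s \<omega>) (\<lambda>t i. Xt i t \<omega>) \<and>
      solves_batch_system T \<tau> N b m K (\<lambda>_. {{1..N}}) (\<lambda>i. X0 i \<omega>) (\<lambda>s i. \<sigma> *\<^sub>R W i s \<omega>) (\<lambda>t i. X i t \<omega>)"
proof -
  interpret kernels N m K A L by fact
  have W: "standard_brownian_motion P (W i)" if "i \<in> {1..N}" for i
    using R that N by (auto simp: random_inputs_def)
  have "AE \<omega> in P. \<forall>i\<in>{1..N}. W i 0 \<omega> = 0 \<and> continuous_on {0..} (\<lambda>t. W i t \<omega>)"
    by (intro AE_finite_allI AE_conjI) (use W in \<open>auto simp: standard_brownian_motion_def\<close>)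
  moreover have "AE \<omega> in P. \<forall>i\<in>{1..N}. continuous_on {0..T} (\<lambda>t. X i t \<omega>) \<and>
        (\<forall>t\<in>{0..T}. X i t \<omega> = X0 i \<omega>
           + integral {0..t} (\<lambda>s. drift b m K {1..N} i (\<lambda>j. X j s \<omega>)) + \<sigma> *\<^sub>R W i t \<omega>)"
    using X by (simp add: full_system_solution_def)
  moreover have "AE \<omega> in P. (\<forall>i\<in>{1..N}. continuous_on {0..T} (\<lambda>t. Xt i t \<omega>) \<and> Xt i 0 \<omega> = X0 i \<omega>) \<and>
        (\<forall>k. \<forall>B\<in>D k \<omega>. \<forall>i\<in>B. \<forall>t\<in>{0..T}. real k * \<tau> \<le> t \<and> t < real (Suc k) * \<tau> \<longrightarrow>
           Xt i t \<omega> = Xt i (real k * \<tau>) \<omega>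
             + integral {real k * \<tau>..t} (\<lambda>s. drift b m K B i (\<lambda>j. Xt j s \<omega>))
             + \<sigma> *\<^sub>R (W i t \<omega> - W i (real k * \<tau>) \<omega>))"
    using Xt by (simp add: random_batch_solution_def)
  ultimately show ?thesis
    using AE_space
  proof eventually_elim
    case (elim \<omega>)
    have d: "batches N p (D k \<omega>)" for k
      using batch_divisions_batches[OF random_inputs_divisions(1)[OF R \<open>\<omega> \<in> space P\<close>]] N by simp
    show ?case
    proof
      show "solves_batch_system T \<tau> N b m K (\<lambda>_. {{1..N}}) (\<lambda>i. X0 i \<omega>) (\<lambda>s i. \<sigma> *\<^sub>R W i s \<omega>)
          (\<lambda>t i. X i t \<omega>)"
        by (rule full_system_solves) (use assms elim in auto)
      show "solves_batch_system T \<tau> N b m K (\<lambda>k. D k \<omega>) (\<lambda>i. X0 i \<omega>) (\<lambda>s i. \<sigma> *\<^sub>R W i s \<omega>)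
          (\<lambda>t i. Xt i t \<omega>)"
      proof (rule batch_system_solves[OF _ _ d])
        fix k B i t
        assume "B \<in> D k \<omega>" "i \<in> B" "t \<in> {0..T}" "real k * \<tau> \<le> t" "t < real (Suc k) * \<tau>"
        with elim(3) have "Xt i t \<omega> = Xt i (real k * \<tau>) \<omega>
             + integral {real k * \<tau>..t} (\<lambda>s. drift b m K B i (\<lambda>j. Xt j s \<omega>))
             + \<sigma> *\<^sub>R (W i t \<omega> - W i (real k * \<tau>) \<omega>)"
          by blast
        then show "Xt i t \<omega> = Xt i (real k * \<tau>) \<omega>
             + integral {real k * \<tau>..t} (\<lambda>s. drift b m K B i (\<lambda>j. Xt j s \<omega>))
             + (\<sigma> *\<^sub>R W i t \<omega> - \<sigma> *\<^sub>R W i (real k * \<tau>) \<omega>)"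
          by (simp add: scaleR_diff_right)
      qed (use assms elim in \<open>auto intro!: continuous_intros\<close>)
    qed
  qed
qed

lemma bounded_paths:
  fixes y :: "real \<Rightarrow> nat \<Rightarrow> 'a::real_normed_vector"
  assumes "finite I" "\<And>i. i \<in> I \<Longrightarrow> continuous_on {0..T} (\<lambda>t. y t i)"
  obtains r :: nat where "\<And>i t. i \<in> I \<Longrightarrow> t \<in> {0..T} \<Longrightarrow> norm (y t i) \<le> real r"
proof -
  have "bounded (\<Union>i\<in>I. (\<lambda>t. y t i) ` {0..T})"
    using assms by (auto intro!: compact_imp_bounded compact_continuous_image)
  then obtain B where B: "\<forall>x\<in>(\<Union>i\<in>I. (\<lambda>t. y t i) ` {0..T}). norm x \<le> B"
    unfolding bounded_iff by blast
  obtain r :: nat where "B \<le> real r" using real_arch_simple by blast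
  with B show thesis by (intro that[of r]) force
qed

text \<open>The radius \<open>r\<close> now tends to infinity. Continuous paths on a compact
  interval are bounded, so almost surely \<open>\<Phi> r \<omega>\<close> equals the true squared
  distance for all large \<open>r\<close>, with a threshold depending on the outcome. As
  \<open>c\<close> involves no \<open>\<Lambda>\<close>, its bound is uniform in \<open>r\<close>
  and passes through Fatou's lemma.\<close>

lemma mean_square_error_bound:
  fixes b :: "real ^ 'd \<Rightarrow> real ^ 'd" and X0 :: "nat \<Rightarrow> 'w \<Rightarrow> real ^ 'd" and \<sigma> :: real
  assumes osl: "\<And>x y. (x - y) \<bullet> (b x - b y) \<le> \<beta> * (norm (x - y))\<^sup>2"
    and local_lipschitz: "\<And>r. 0 \<le> r \<Longrightarrow> \<exists>l\<ge>0. \<forall>x y. norm x \<le> r \<longrightarrow> norm y \<le> r \<longrightarrow>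
      norm (b x - b y) \<le> l * norm (x - y)"
    and b: "continuous_on UNIV b"
    and R: "random_inputs P n p X0 W D" and N: "N = n * p" "2 \<le> p" "2 \<le> N"
    and kernels: "kernels N m K A L" and "0 < \<tau>" and t: "t \<in> {0..T}"
    and X: "full_system_solution P T N \<sigma> b m K X0 W X"
    and Xt: "random_batch_solution P T N \<sigma> b m K X0 W \<tau> D Xt"
  defines "\<kappa> \<equiv> \<bar>\<beta>\<bar> + 2"
  defines "c \<equiv> T * exp ((2 * \<kappa> + 1 + 4 * (A * L)) * T) * (8 * (A * L)\<^sup>2 * (exp (\<kappa> * T) + 1))"
  shows "(\<integral>\<^sup>+\<omega>. ennreal (\<Sum>i=1..N. (norm (Xt i t \<omega> - X i t \<omega>))\<^sup>2) \<partial>P) \<le> ennreal (c * \<tau> * real N)"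
proof -
  let ?w = "\<lambda>\<omega> s i. \<sigma> *\<^sub>R W i s \<omega>"
  have T0: "0 \<le> T" using t by simp
  have "\<exists>\<Phi>\<in>borel_measurable P. (\<integral>\<^sup>+\<omega>. \<Phi> \<omega> \<partial>P) \<le> ennreal (c * \<tau> * real N) \<and>
    (\<forall>\<omega>\<in>space P. \<forall>y z.
      solves_batch_system T \<tau> N b m K (\<lambda>k. D k \<omega>) (\<lambda>i. X0 i \<omega>) (?w \<omega>) y \<longrightarrow>
      solves_batch_system T \<tau> N b m K (\<lambda>_. {{1..N}}) (\<lambda>i. X0 i \<omega>) (?w \<omega>) z \<longrightarrow>
      (\<forall>i\<in>{1..N}. \<forall>s\<in>{0..T}. norm (y s i) \<le> real r \<and> norm (z s i) \<le> real r) \<longrightarrow>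
      \<Phi> \<omega> = ennreal (\<Sum>i=1..N. (norm (y t i - z t i))\<^sup>2))" (is "\<exists>\<Phi>\<in>_. ?good r \<Phi>") for r :: nat
  proof -
    obtain l where l: "l \<ge> 0"
      "\<And>x y. norm x \<le> real r \<Longrightarrow> norm y \<le> real r \<Longrightarrow> norm (b x - b y) \<le> l * norm (x - y)"
      using local_lipschitz[of "real r"] by auto
    obtain f \<Lambda> where f: "\<Lambda> \<ge> 0" "\<And>x y. norm (f x - f y) \<le> \<Lambda> * norm (x - y)"
      "\<And>x y. (x - y) \<bullet> (f x - f y) \<le> (\<bar>\<beta>\<bar> + 1) * (norm (x - y))\<^sup>2"
      "\<And>x. norm x \<le> real r \<Longrightarrow> f x = b x"
      using one_sided_lipschitz_truncation[OF osl l(2) _ l(1)] by (metis of_nat_0_le_iff)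
    interpret kernels N m K A L by (rule kernels)
    \<comment> \<open>Of the 2 in \<open>\<kappa>\<close>, one unit is lost in the truncation and
      one is the reserve of the Euler scheme.\<close>
    have \<kappa>: "\<kappa> - 1 = \<bar>\<beta>\<bar> + 1" "1 \<le> \<kappa>" by (simp_all add: \<kappa>_def)
    interpret truncated_system N m K A L f \<kappa> \<Lambda> \<tau>
      by unfold_locales (rule f(2) f(3)[folded \<kappa>(1)] \<kappa>(2) f(1) \<open>0 < \<tau>\<close>)+
    show ?thesis
      unfolding c_def by (rule limit_mean_square_error[OF R N t f(4)])
  qed
  then have "\<forall>r. \<exists>\<Phi>. \<Phi> \<in> borel_measurable P \<and> ?good r \<Phi>" by blast
  then obtain \<Phi> where \<Phi>: "\<And>r. \<Phi> r \<in> borel_measurable P" "\<And>r. ?good r (\<Phi> r)"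
    using choice[of "\<lambda>r \<Phi>. \<Phi> \<in> borel_measurable P \<and> ?good r \<Phi>"] by blast
  have "AE \<omega> in P. ennreal (\<Sum>i=1..N. (norm (Xt i t \<omega> - X i t \<omega>))\<^sup>2) = liminf (\<lambda>r. \<Phi> r \<omega>)"
    using AE_solves_batch_system[OF R N kernels b \<open>0 < \<tau>\<close> T0 X Xt] AE_space
  proof eventually_elim
    case (elim \<omega>)
    then have y: "solves_batch_system T \<tau> N b m K (\<lambda>k. D k \<omega>) (\<lambda>i. X0 i \<omega>) (?w \<omega>) (\<lambda>t i. Xt i t \<omega>)"
      and z: "solves_batch_system T \<tau> N b m K (\<lambda>_. {{1..N}}) (\<lambda>i. X0 i \<omega>) (?w \<omega>) (\<lambda>t i. X i t \<omega>)"
      using t by auto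
    obtain r1 where r1: "\<And>i s. i \<in> {1..N} \<Longrightarrow> s \<in> {0..T} \<Longrightarrow> norm (Xt i s \<omega>) \<le> real r1"
      using bounded_paths[of "{1..N}" T "\<lambda>t i. Xt i t \<omega>"] y unfolding solves_batch_system_def by auto
    obtain r2 where r2: "\<And>i s. i \<in> {1..N} \<Longrightarrow> s \<in> {0..T} \<Longrightarrow> norm (X i s \<omega>) \<le> real r2"
      using bounded_paths[of "{1..N}" T "\<lambda>t i. X i t \<omega>"] z unfolding solves_batch_system_def by auto
    have "\<Phi> r \<omega> = ennreal (\<Sum>i=1..N. (norm (Xt i t \<omega> - X i t \<omega>))\<^sup>2)" if r: "r \<ge> max r1 r2" for r
    proof -
      have "\<forall>i\<in>{1..N}. \<forall>s\<in>{0..T}. norm (Xt i s \<omega>) \<le> real r \<and> norm (X i s \<omega>) \<le> real r"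
      proof (intro ballI)
        fix i s assume "i \<in> {1..N}" "s \<in> {0..T}"
        from r1[OF this] r2[OF this] r show "norm (Xt i s \<omega>) \<le> real r \<and> norm (X i s \<omega>) \<le> real r"
          by (auto intro: order_trans)
      qed
      then show ?thesis
        using \<Phi>(2)[of r, THEN conjunct2, rule_format, OF \<open>\<omega> \<in> space P\<close> y z] by blast
    qed
    then have "\<forall>\<^sub>F r in sequentially. \<Phi> r \<omega> = ennreal (\<Sum>i=1..N. (norm (Xt i t \<omega> - X i t \<omega>))\<^sup>2)"
      unfolding eventually_sequentially by blast
    then show ?case
      by (intro lim_imp_Liminf[symmetric] tendsto_eventually) auto
  qed
  then have "(\<integral>\<^sup>+\<omega>. ennreal (\<Sum>i=1..N. (norm (Xt i t \<omega> - X i t \<omega>))\<^sup>2) \<partial>P) = (\<integral>\<^sup>+\<omega>. liminf (\<lambda>r. \<Phi> r \<omega>) \<partial>P)"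
    by (rule nn_integral_cong_AE)
  also have "\<dots> \<le> liminf (\<lambda>r. \<integral>\<^sup>+\<omega>. \<Phi> r \<omega> \<partial>P)"
    using \<Phi>(1) by (rule nn_integral_liminf)
  also have "\<dots> \<le> liminf (\<lambda>r :: nat. ennreal (c * \<tau> * real N))"
    by (intro Liminf_mono always_eventually allI \<Phi>(2)[THEN conjunct1])
  finally show ?thesis by (simp add: Liminf_const)
qed

lemma weighted_error_le:
  assumes m: "\<And>i. i \<in> {1..N} \<Longrightarrow> 0 \<le> m i \<and> m i \<le> A" and "0 \<le> A" "0 \<le> e" "N > 0"
    and meas: "\<And>i. i \<in> {1..N} \<Longrightarrow> X i t \<in> borel_measurable P \<and> Xt i t \<in> borel_measurable P"
    and e: "(\<integral>\<^sup>+\<omega>. ennreal (\<Sum>i=1..N. (norm (Xt i t \<omega> - X i t \<omega>))\<^sup>2) \<partial>P) \<le> ennreal (e * real N)"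
  shows "weighted_error P N m Xt X t \<le> ennreal (A / 2 * e)"
proof -
  let ?q = "\<lambda>i \<omega>. ennreal ((norm (Xt i t \<omega> - X i t \<omega>))\<^sup>2)"
  have "(\<Sum>i\<in>{1..N}. ennreal (m i) * (\<integral>\<^sup>+\<omega>. ?q i \<omega> \<partial>P)) \<le> (\<Sum>i\<in>{1..N}. ennreal A * (\<integral>\<^sup>+\<omega>. ?q i \<omega> \<partial>P))"
    by (intro sum_mono mult_right_mono ennreal_leI) (use m in auto)
  also have "\<dots> = ennreal A * (\<Sum>i\<in>{1..N}. \<integral>\<^sup>+\<omega>. ?q i \<omega> \<partial>P)" by (simp add: sum_distrib_left)
  also have "(\<Sum>i\<in>{1..N}. \<integral>\<^sup>+\<omega>. ?q i \<omega> \<partial>P) = (\<integral>\<^sup>+\<omega>. (\<Sum>i\<in>{1..N}. ?q i \<omega>) \<partial>P)"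
  proof (rule nn_integral_sum[symmetric])
    fix i assume "i \<in> {1..N}"
    then have "(\<lambda>\<omega>. Xt i t \<omega> - X i t \<omega>) \<in> borel_measurable P"
      using meas by (intro borel_measurable_diff) auto
    then show "?q i \<in> borel_measurable P" by (rule measurable_compose) simp
  qed
  also have "\<dots> = (\<integral>\<^sup>+\<omega>. ennreal (\<Sum>i=1..N. (norm (Xt i t \<omega> - X i t \<omega>))\<^sup>2) \<partial>P)"
    by (simp add: sum_ennreal)
  also have "ennreal A * \<dots> \<le> ennreal A * ennreal (e * real N)"
    by (intro mult_left_mono e) simp
  finally have "weighted_error P N m Xt X t \<le> ennreal (1 / (2 * real N)) * (ennreal A * ennreal (e * real N))"
    unfolding weighted_error_def by (intro mult_left_mono) auto
  also have "ennreal A * ennreal (e * real N) = ennreal (A * (e * real N))"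
    using \<open>0 \<le> A\<close> by (rule ennreal_mult'[symmetric])
  also have "ennreal (1 / (2 * real N)) * \<dots> = ennreal (1 / (2 * real N) * (A * (e * real N)))"
    by (rule ennreal_mult'[symmetric]) simp
  also have "1 / (2 * real N) * (A * (e * real N)) = A / 2 * e" using \<open>N > 0\<close> by simp
  finally show ?thesis .
qed

theorem theorem3p1:
  fixes T \<sigma> A M \<beta> C\<^sub>b q L :: real
    and b :: "real ^ 'd \<Rightarrow> real ^ 'd"
  assumes "T > 0" and "A > 0" and "M > 0"
    and one_sided_Lipschitz:
      "\<And>z\<^sub>1 z\<^sub>2. (z\<^sub>1 - z\<^sub>2) \<bullet> (b z\<^sub>1 - b z\<^sub>2) \<le> \<beta> * (norm (z\<^sub>1 - z\<^sub>2))\<^sup>2"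
    and b_differentiable: "\<And>z. b differentiable (at z)"
    and polynomial_growth:
      "\<And>z. norm (b z) + onorm (frechet_derivative b (at z)) \<le> C\<^sub>b * (1 + norm z) powr q"
  shows "\<exists>C::real. \<forall>(n::nat) (p::nat) (\<tau>::real) (m :: nat \<Rightarrow> real)
      (K :: nat \<Rightarrow> nat \<Rightarrow> (real ^ 'd) \<times> (real ^ 'd) \<Rightarrow> real ^ 'd)
      (P :: 'w measure) (X0 :: nat \<Rightarrow> 'w \<Rightarrow> real ^ 'd) (W :: nat \<Rightarrow> real \<Rightarrow> 'w \<Rightarrow> real ^ 'd)
      (D :: nat \<Rightarrow> 'w \<Rightarrow> nat set set) (N::nat)
      (X :: nat \<Rightarrow> real \<Rightarrow> 'w \<Rightarrow> real ^ 'd) (Xt :: nat \<Rightarrow> real \<Rightarrow> 'w \<Rightarrow> real ^ 'd).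
      N = n * p \<and> n \<ge> 1 \<and> p \<ge> 2 \<and> \<tau> > 0 \<and>
      (\<forall>j\<in>{1..N}. 0 \<le> m j \<and> \<bar>m j\<bar> \<le> A) \<and>
      (1 / real N) * (\<Sum>j\<in>{1..N}. m j) = M \<and>
      (\<forall>i\<in>{1..N}. \<forall>j\<in>{1..N}. C2_bounded_by L (K i j)) \<and>
      random_inputs P n p X0 W D \<and>
      full_system_solution P T N \<sigma> b m K X0 W X \<and>
      random_batch_solution P T N \<sigma> b m K X0 W \<tau> D Xt
      \<longrightarrow> (SUP t\<in>{0..T}. weighted_error P N m Xt X t)
            \<le> ennreal (C * sqrt (\<tau> / (real p - 1) + \<tau>\<^sup>2))"
proof -
  define \<kappa> where "\<kappa> = \<bar>\<beta>\<bar> + 2"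
  define c where "c = T * exp ((2 * \<kappa> + 1 + 4 * (A * L)) * T) * (8 * (A * L)\<^sup>2 * (exp (\<kappa> * T) + 1))"
  have c: "0 \<le> c" using \<open>T > 0\<close> by (simp add: c_def)
  have b_cont: "continuous_on UNIV b"
    using b_differentiable by (auto intro!: differentiable_imp_continuous_on simp: differentiable_on_def)
  have local_lipschitz: "\<exists>l\<ge>0. \<forall>x y. norm x \<le> r \<longrightarrow> norm y \<le> r \<longrightarrow> norm (b x - b y) \<le> l * norm (x - y)"
    if "0 \<le> r" for r
    using locally_lipschitz_of_derivative_growth[OF b_differentiable polynomial_growth that] by metis
  show ?thesis
  \<comment> \<open>\<open>A\<close> bounds the weights and 1/2 is the prefactor of the error;
    \<open>c\<close> depends on \<open>T\<close>, \<open>A\<close>, \<open>L\<close> and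
    \<open>\<beta>\<close> only.\<close>
  proof (intro exI[of _ "A / 2 * c"] allI impI, elim conjE)
    fix n p :: nat and \<tau> :: real and m :: "nat \<Rightarrow> real"
      and K :: "nat \<Rightarrow> nat \<Rightarrow> (real ^ 'd) \<times> (real ^ 'd) \<Rightarrow> real ^ 'd"
      and P :: "'w measure" and X0 :: "nat \<Rightarrow> 'w \<Rightarrow> real ^ 'd" and W :: "nat \<Rightarrow> real \<Rightarrow> 'w \<Rightarrow> real ^ 'd"
      and D :: "nat \<Rightarrow> 'w \<Rightarrow> nat set set" and N :: nat
      and X :: "nat \<Rightarrow> real \<Rightarrow> 'w \<Rightarrow> real ^ 'd" and Xt :: "nat \<Rightarrow> real \<Rightarrow> 'w \<Rightarrow> real ^ 'd"
    assume N: "N = n * p" and np: "n \<ge> 1" "p \<ge> 2" and "\<tau> > 0"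
      and m: "\<forall>j\<in>{1..N}. 0 \<le> m j \<and> \<bar>m j\<bar> \<le> A"
      and K: "\<forall>i\<in>{1..N}. \<forall>j\<in>{1..N}. C2_bounded_by L (K i j)"
      and R: "random_inputs P n p X0 W D"
      and X: "full_system_solution P T N \<sigma> b m K X0 W X"
      and Xt: "random_batch_solution P T N \<sigma> b m K X0 W \<tau> D Xt"
    have N2: "2 \<le> N" using mult_le_mono[OF np] N by simp
    \<comment> \<open>The sign of \<open>L\<close> follows because it bounds the norm of a kernel
      value; 1 is a valid index as \<open>N \<ge> 2\<close>.\<close>
    have "0 \<le> norm (K 1 1 0)" by simp
    also have "\<dots> \<le> L" using K N2 by (intro C2_bounded_by_bound) auto
    finally have L: "0 \<le> L" .
    have kernels: "kernels N m K A L"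
    proof
      show "norm (K i j z) \<le> L" if "i \<in> {1..N}" "j \<in> {1..N}" for i j z
        using K that by (intro C2_bounded_by_bound) blast
      show "norm (K i j z - K i j z') \<le> L * norm (z - z')" if "i \<in> {1..N}" "j \<in> {1..N}" for i j z z'
        using K that by (intro C2_bounded_by_lipschitz) blast
    qed (use m L \<open>A > 0\<close> in \<open>auto simp: abs_le_iff\<close>)
    \<comment> \<open>The bound of order \<open>\<tau>\<close> is weakened here to the claimed form:
      \<open>\<tau>\<close> is the root of the second summand alone.\<close>
    have tau: "\<tau> \<le> sqrt (\<tau> / (real p - 1) + \<tau>\<^sup>2)"
      using np \<open>\<tau> > 0\<close> by (intro real_le_rsqrt) auto
    have "weighted_error P N m Xt X t \<le> ennreal (A / 2 * c * sqrt (\<tau> / (real p - 1) + \<tau>\<^sup>2))"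
      if t: "t \<in> {0..T}" for t
    proof -
      have "weighted_error P N m Xt X t \<le> ennreal (A / 2 * (c * \<tau>))"
      proof (rule weighted_error_le)
        show "(\<integral>\<^sup>+\<omega>. ennreal (\<Sum>i=1..N. (norm (Xt i t \<omega> - X i t \<omega>))\<^sup>2) \<partial>P) \<le> ennreal (c * \<tau> * real N)"
          unfolding c_def \<kappa>_def
          by (rule mean_square_error_bound[OF one_sided_Lipschitz local_lipschitz b_cont R N np(2) N2
                kernels \<open>\<tau> > 0\<close> t X Xt])
        show "X i t \<in> borel_measurable P \<and> Xt i t \<in> borel_measurable P" if "i \<in> {1..N}" for i
          using X Xt t that by (auto simp: full_system_solution_def random_batch_solution_def)
      qed (use m \<open>A > 0\<close> \<open>\<tau> > 0\<close> c N2 in \<open>auto simp: abs_le_iff\<close>)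
      also have "A / 2 * (c * \<tau>) \<le> A / 2 * c * sqrt (\<tau> / (real p - 1) + \<tau>\<^sup>2)"
        using mult_left_mono[OF tau, of "A / 2 * c"] c \<open>A > 0\<close> by simp
      finally show ?thesis by (simp add: ennreal_leI)
    qed
    then show "(SUP t\<in>{0..T}. weighted_error P N m Xt X t)
        \<le> ennreal (A / 2 * c * sqrt (\<tau> / (real p - 1) + \<tau>\<^sup>2))"
      by (rule SUP_least)
  qed
qed

end
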